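(* Let $G$ be a finite nilpotent group and $H$ an arbitrary finite group. Then $\mathrm{Pow}(G)\cong \mathrm{Pow}(H)$ if and only if $H$ is nilpotent and, for every prime $p$, $\mathrm{Pow}(G_p)\cong \mathrm{Pow}(H_p)$, where $G_p$ and $H_p$ denote the Sylow $p$-subgroups of $G$ and $H$, respectively.
   Context: All groups are finite. For a group $X$, the (undirected) power graph $\mathrm{Pow}(X)$ is the simple graph with vertex set $X$ in which two distinct vertices $x,y$ are adjacent if and only if $y\in\langle x\rangle$ or $x\in\langle y\rangle$. *)

theory Defs
  imports "HOL-Algebra.Algebra"
begin

definition lower_central_step :: "('a, 'b) monoid_scheme \<Rightarrow> 'a set \<Rightarrow> 'a set" where
  "lower_central_step G K = generate G
     (\<Union>h \<in> K. \<Union>g \<in> carrier G. {h \<otimes>\<^bsub>G\<^esub> g \<otimes>\<^bsub>G\<^esub> inv\<^bsub>G\<^esub> h \<otimes>\<^bsub>G\<^esub> inv\<^bsub>G\<^esub> g})"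

definition nilpotent_group :: "('a, 'b) monoid_scheme \<Rightarrow> bool" where
  "nilpotent_group G \<longleftrightarrow> group G \<and>
     (\<exists>n. (lower_central_step G ^^ n) (carrier G) = {\<one>\<^bsub>G\<^esub>})"

definition power_adj :: "('a, 'b) monoid_scheme \<Rightarrow> 'a \<Rightarrow> 'a \<Rightarrow> bool" where
  "power_adj G x y \<longleftrightarrow> x \<noteq> y \<and> (y \<in> generate G {x} \<or> x \<in> generate G {y})"

definition power_graph_iso :: "('a, 'b) monoid_scheme \<Rightarrow> ('c, 'd) monoid_scheme \<Rightarrow> bool" where
  "power_graph_iso G H \<longleftrightarrow> (\<exists>f. bij_betw f (carrier G) (carrier H) \<and>
     (\<forall>x \<in> carrier G. \<forall>y \<in> carrier G. power_adj G x y \<longleftrightarrow> power_adj H (f x) (f y)))"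

definition sylow_subgroup :: "('a, 'b) monoid_scheme \<Rightarrow> nat \<Rightarrow> 'a set \<Rightarrow> bool" where
  "sylow_subgroup G p P \<longleftrightarrow> subgroup P G \<and> card P = p ^ multiplicity p (order G)"

end

theory Submission
  imports Defs "HOL-Number_Theory.Number_Theory"
begin

text \<open>
  Call two elements of a finite group twins if they have the same closed neighbourhood in the power graph.
  Unless the group is cyclic and not of prime power order, a twin class is the set of generators of a cyclic
  subgroup or an interval in a chain of cyclic \<open>p\<close>-subgroups, and the neighbourhoods determine which of two
  adjacent classes lies below the other.  Hence the power graph determines its directed version and
  the number of elements of each order (Cameron).  Nilpotency is visible in these numbers: it means that for
  each prime \<open>p\<close> the number of \<open>p\<close>-elements is the \<open>p\<close>-part of the group order, and then the \<open>p\<close>-elements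
  form the Sylow \<open>p\<close>-subgroup.  Conversely, directed isomorphisms of the Sylow subgroups are glued along
  the bijection from a nilpotent group to the product of its Sylow subgroups given by the powers
  \<open>x \<mapsto> x ^ u p\<close> with \<open>u p\<close> congruent to \<open>1\<close> modulo the \<open>p\<close>-part of the order and to \<open>0\<close> modulo its
  \<open>p'\<close>-part.
\<close>

section \<open>Prime powers and Euler's function\<close>

hide_const (open) Divisibility.prime

text \<open>An isomorphism of power graphs can be composed with any permutation of a twin class, so
  it need not preserve orders or even the identity; what survives is the number of elements of each
  order in each class. The given bijection is therefore replaced by one that respects both classes
  and orders. In the exceptional cyclic groups the generators are twins of the identity although
  elements between them are not, so classes fail to be intervals; but a cyclic group is determined
  by its order. Directions are also what makes gluing possible: adjacency in a nilpotent group
  demands that the primary parts lie below one another in the same direction for all primes at once,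
  which undirected isomorphisms of the Sylow subgroups do not control. Nilpotency is defined by the
  lower central series while the counts concern single elements; the bridge is the condition that
  elements whose orders are powers of distinct primes commute. It follows from either side, implies
  both, and passes to quotients.\<close>

definition prime_power :: "nat \<Rightarrow> bool" where
  "prime_power n \<longleftrightarrow> (\<exists>p k. prime p \<and> n = p ^ k)"

lemma prime_power_dvd_total:
  assumes "prime_power n" "a dvd n" "b dvd n"
  shows "a dvd b \<or> b dvd a"
proof -
  obtain p k where p: "prime p" "n = p ^ k" using assms(1) by (auto simp: prime_power_def)
  obtain i j where "a = p ^ i" "b = p ^ j"
    using assms p by (metis divides_primepow_nat)
  then show ?thesis by (meson le_imp_power_dvd nat_le_linear)
qed

lemma prime_power_dvd: "prime_power n \<Longrightarrow> a dvd n \<Longrightarrow> prime_power a"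
  unfolding prime_power_def by (metis divides_primepow_nat)

lemma prime_power_1 [simp]: "prime_power (Suc 0)"
  unfolding prime_power_def by (metis power_0 two_is_prime_nat One_nat_def)

lemma prime_power_if_unique_prime:
  fixes n :: nat
  assumes "n > 0" "\<And>r. prime r \<Longrightarrow> r dvd n \<Longrightarrow> r = q"
  shows "prime_power n"
proof (cases "n = 1")
  case False
  then obtain r where "prime r" "r dvd n" using prime_factor_nat by blast
  then have "prime_factors n = {q}" "prime q" using assms by (auto simp: prime_factors_dvd)
  then have "n = q ^ multiplicity q n" using prime_factorization_nat[OF assms(1)] by simp
  then show ?thesis using \<open>prime q\<close> unfolding prime_power_def by blast
qed simp

text \<open>Let \<open>q\<close> be a prime dividing \<open>n div m\<close>. The full
  \<open>q\<close>-part of \<open>n\<close> does not divide \<open>m\<close>, so it is a multiple of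
  \<open>m\<close>, and \<open>m\<close> is a power of \<open>q\<close>. A prime divisor of
  \<open>n\<close> either divides \<open>m\<close> or is a multiple of \<open>m\<close>, and equals
  \<open>q\<close> in both cases.\<close>

lemma prime_power_if_comparable_divisor:
  fixes m n :: nat
  assumes "m dvd n" "1 < m" "m < n" and cmp: "\<And>d. d dvd n \<Longrightarrow> d dvd m \<or> m dvd d"
  shows "prime_power n"
proof -
  have n0: "n > 0" using assms by simp
  obtain k where k: "n = m * k" using assms by (elim dvdE)
  have "k \<noteq> 1" using k assms by auto
  then obtain q where q: "prime q" "q dvd k" using prime_factor_nat by blast
  define a where "a = multiplicity q n"
  have "q * m dvd n" using k q by (metis mult.commute mult_dvd_mono dvd_refl)
  then have "multiplicity q (q * m) \<le> a"
    unfolding a_def using n0 by (intro dvd_imp_multiplicity_le) auto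
  then have lt: "multiplicity q m < a"
    using q assms by (simp add: prime_elem_multiplicity_mult_distrib)
  have "\<not> q ^ a dvd m"
    using lt q assms by (metis leD multiplicity_geI not_prime_unit not_less_zero gr_implies_not0)
  moreover have "q ^ a dvd n" unfolding a_def by (rule multiplicity_dvd)
  ultimately have "m dvd q ^ a" using cmp by blast
  then obtain b where b: "m = q ^ b" using q divides_primepow_nat by blast
  have "b \<noteq> 0" using b assms by (cases b) auto
  have "r = q" if "prime r" "r dvd n" for r
  proof -
    from cmp[OF that(2)] show ?thesis
    proof
      assume "r dvd m" then show ?thesis using b that(1) q(1)
        by (metis prime_dvd_power primes_dvd_imp_eq)
    next
      assume "m dvd r"
      then have "q dvd r" using b \<open>b \<noteq> 0\<close> by (meson dvd_power dvd_trans bot_nat_0.not_eq_extremum)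
      then show ?thesis using that(1) q(1) by (metis primes_dvd_imp_eq)
    qed
  qed
  then show ?thesis using prime_power_if_unique_prime n0 by blast
qed

lemma totient_mult_prime:
  fixes m q :: nat
  assumes "prime q"
  shows "totient (m * q) = totient m * (if q dvd m then q else q - 1)"
proof (cases "q dvd m")
  case True
  then have "gcd m q = q" by (simp add: gcd_nat.absorb2)
  then have "totient (m * q) * totient q = totient m * totient q * q"
    using totient_gcd[of m q] by simp
  then show ?thesis using True assms by (simp add: prime_gt_0_nat)
next
  case False
  then have "coprime m q" using assms by (metis coprime_commute prime_imp_coprime)
  then show ?thesis using assms False by (simp add: totient_mult_coprime totient_prime)
qed

text \<open>Appending a prime factor \<open>q\<close> multiplies the totient by \<open>q\<close> or
  by \<open>q - 1\<close>. The factor is 1 only for \<open>q = 2\<close> and an odd number, and this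
  can happen only once, since the number is even afterwards.\<close>

lemma totient_eq_imp_double:
  fixes m n :: nat
  assumes "m dvd n" "n > 0" "m \<noteq> n" "totient m = totient n"
  shows "n = 2 * m \<and> odd m"
proof -
  obtain k where k: "n = m * k" using assms by (elim dvdE)
  have k2: "k \<ge> 2" using k assms by (cases "k = 0 \<or> k = 1") auto
  have m0: "m > 0" using k assms by (cases m) auto
  have tm: "totient m > 0" using m0 by simp
  have le: "totient d \<le> totient m" if "d dvd n" for d
    using totient_dvd_mono[OF that assms(2)] assms(4) by simp
  have two: "q = 2 \<and> odd m" if q: "prime q" "q dvd k" for q
  proof -
    have "m * q dvd n" using k q by (simp add: mult_dvd_mono)
    from le[OF this] have "totient m * (if q dvd m then q else q - 1) \<le> totient m * 1"
      unfolding totient_mult_prime[OF q(1)] by simp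
    then have "(if q dvd m then q else q - 1) \<le> 1" using tm mult_le_cancel1 by blast
    then have "\<not> q dvd m" "q = 2" using prime_ge_2_nat[OF q(1)] by (auto split: if_splits)
    then show ?thesis by simp
  qed
  obtain q where q: "prime q" "q dvd k" using k2 prime_factor_nat[of k] by auto
  then obtain j where j: "k = 2 * j" using two by (metis dvdE)
  have "j = 1"
  proof (rule ccontr)
    assume "j \<noteq> 1"
    then obtain r where r: "prime r" "r dvd j" using prime_factor_nat[of j] by auto
    then have "r = 2" using two j by simp
    then have "m * 2 * 2 dvd n" using k j r by simp
    from le[OF this] have "totient (m * 2) * 2 \<le> totient m"
      using totient_mult_prime[of 2 "m * 2"] by simp
    moreover have "totient (m * 2) = totient m" using totient_mult_prime[of 2 m] two[OF q] by simp
    ultimately show False using tm by simp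
  qed
  then show ?thesis using k j two[OF q] by simp
qed

section \<open>Cyclic subgroups\<close>

lemma (in group) ord_dvd_card_subgroup:
  assumes K: "subgroup K G" and x: "x \<in> K"
  shows "ord x dvd card K"
proof -
  have xc: "x \<in> carrier G" by (rule subgroup.mem_carrier[OF K x])
  have "generate G {x} \<subseteq> K" using generate_subgroup_incl[of "{x}" K] x K by blast
  then have sub: "subgroup (generate G {x}) (G\<lparr>carrier := K\<rparr>)"
    using K xc by (intro subgroup_incl generate_is_subgroup) auto
  have "card (generate G {x}) dvd order (G\<lparr>carrier := K\<rparr>)"
    using group.lagrange[OF subgroup_imp_group[OF K] sub] by (metis dvd_triv_right)
  then show ?thesis using generate_pow_card[OF xc] by (simp add: order_def)
qed

locale finite_group = group +
  assumes fin [simp]: "finite (carrier G)"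
begin

lemma mem_generate_iff:
  assumes "y \<in> carrier G"
  shows "x \<in> generate G {y} \<longleftrightarrow> (\<exists>k::nat. x = y [^] k)"
  using generate_pow_on_finite_carrier[OF fin assms] by auto

lemma generate_closed: "y \<in> carrier G \<Longrightarrow> x \<in> generate G {y} \<Longrightarrow> x \<in> carrier G"
  by (auto simp: mem_generate_iff)

lemma generate_refl: "x \<in> generate G {x}"
  by (simp add: generate.incl)

lemma generate_trans:
  assumes "z \<in> carrier G" "x \<in> generate G {y}" "y \<in> generate G {z}"
  shows "x \<in> generate G {z}"
proof -
  have "subgroup (generate G {z}) G" using assms by (intro generate_is_subgroup) auto
  then show ?thesis using generate_subgroup_incl[of "{y}"] assms by blast
qed

lemma one_mem_generate: "\<one> \<in> generate G {x}"
  by (rule generate.one)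

lemma ord_pos: "x \<in> carrier G \<Longrightarrow> ord x > 0"
  using ord_ge_1 fin by fastforce

lemma ord_gt_1:
  assumes "x \<in> carrier G" "x \<noteq> \<one>"
  shows "ord x > 1"
proof -
  have "ord x \<noteq> 1" using assms ord_eq_1 by blast
  then show ?thesis using ord_pos[OF assms(1)] by linarith
qed

lemma card_generate: "x \<in> carrier G \<Longrightarrow> card (generate G {x}) = ord x"
  using generate_pow_card by simp

lemma finite_generate: "x \<in> carrier G \<Longrightarrow> finite (generate G {x})"
  by (rule finite_subset[OF _ fin]) (auto simp: generate_closed)

lemma ord_dvd_of_mem_generate:
  assumes "y \<in> carrier G" "x \<in> generate G {y}"
  shows "ord x dvd ord y"
proof -
  obtain k :: nat where k: "x = y [^] k" using assms mem_generate_iff by blast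
  have "x [^] ord y = \<one>" using assms k by (metis mult.commute nat_pow_pow pow_ord_eq_1 nat_pow_one)
  then show ?thesis using assms generate_closed pow_eq_id by blast
qed

lemma ord_le_of_mem_generate:
  "y \<in> carrier G \<Longrightarrow> x \<in> generate G {y} \<Longrightarrow> ord x \<le> ord y"
  using ord_dvd_of_mem_generate ord_pos dvd_imp_le by blast

text \<open>A cyclic group has only one subgroup of each order. With \<open>n = ord y\<close> and
  \<open>z\<close> the power of \<open>y\<close> to the exponent \<open>b\<close>, Bezout's identity
  shows that \<open>z\<close> generates the power of \<open>y\<close> to the exponent
  \<open>gcd b n\<close>, and \<open>ord x dvd n div gcd b n\<close> forces the exponent of
  \<open>x\<close> to be a multiple of that gcd.\<close>

lemma mem_generate_iff_ord_dvd:
  assumes y: "y \<in> carrier G" and x: "x \<in> generate G {y}" and z: "z \<in> generate G {y}"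
  shows "x \<in> generate G {z} \<longleftrightarrow> ord x dvd ord z"
proof
  assume "x \<in> generate G {z}"
  then show "ord x dvd ord z" using ord_dvd_of_mem_generate generate_closed[OF y z] by blast
next
  assume d: "ord x dvd ord z"
  have cl: "x \<in> carrier G" "z \<in> carrier G" using generate_closed y x z by blast+
  obtain a :: nat where a: "x = y [^] a" using x y mem_generate_iff by blast
  \<comment> \<open>Adding \<open>ord y\<close> makes the exponent positive, as the formula for the
    order of a power and Bezout's identity are stated for that case.\<close>
  obtain b :: nat where b: "z = y [^] b" "b > 0"
  proof -
    obtain b :: nat where "z = y [^] b" using z y mem_generate_iff by blast
    then have "z = y [^] (b + ord y)" using y by (simp flip: nat_pow_mult)
    then show thesis using that[of "b + ord y"] ord_pos[OF y] by simp
  qed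
  define n where "n = ord y"
  define g where "g = gcd b n"
  have n0: "n > 0" unfolding n_def using ord_pos y by simp
  have oz: "ord z = n div g"
    using ord_pow_gen[OF y, of b] b unfolding n_def g_def by (simp add: gcd.commute)
  have gn: "g dvd n" unfolding g_def by simp
  have "x [^] (n div g) = \<one>" using d oz pow_eq_id cl by simp
  then have "n dvd a * (n div g)" using a y by (simp add: nat_pow_pow pow_eq_id n_def)
  moreover obtain h where h: "n = g * h" using gn by (elim dvdE)
  ultimately have "g dvd a" using n0 by simp
  then obtain c where c: "a = g * c" by (elim dvdE)
  obtain u v where uv: "b * u = n * v + g"
    using bezout_nat[of b n] b(2) unfolding g_def by auto
  have "z [^] (u * c) = y [^] (n * (v * c) + g * c)"
    using b y uv by (metis nat_pow_pow distrib_right mult.assoc)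
  also have "\<dots> = y [^] (n * (v * c)) \<otimes> y [^] a" using y c by (simp add: nat_pow_mult)
  also have "y [^] (n * (v * c)) = \<one>" using y pow_eq_id n_def by simp
  finally have "z [^] (u * c) = x" using a y by simp
  then show "x \<in> generate G {z}" using mem_generate_iff cl by blast
qed

lemma ex_ord_in_generate:
  assumes y: "y \<in> carrier G" and d: "d dvd ord y"
  obtains z where "z \<in> generate G {y}" "ord z = d"
proof -
  obtain e where e: "ord y = d * e" using d by (elim dvdE)
  then have "e \<noteq> 0" using ord_pos[OF y] by auto
  then have "ord (y [^] e) = d" using ord_pow[OF y, of e] e by simp
  then show ?thesis using that mem_generate_iff y by blast
qed

lemma card_generators:
  assumes z: "z \<in> carrier G"
  shows "card {x \<in> generate G {z}. ord x = ord z} = totient (ord z)"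
proof -
  have "inj_on (\<lambda>k. z [^] k) {1..ord z}"
  proof (rule inj_onI)
    fix i j :: nat assume ij: "i \<in> {1..ord z}" "j \<in> {1..ord z}" "z [^] i = z [^] j"
    then have "int (ord z) dvd int j - int i" using int_pow_eq[OF z, of "int i" "int j"] by (simp add: int_pow_int)
    moreover have "\<bar>int j - int i\<bar> < int (ord z)" using ij by auto
    ultimately show "i = j" using zdvd_imp_le[of "int (ord z)" "\<bar>int j - int i\<bar>"] by fastforce
  qed
  then have inj: "inj_on (\<lambda>k. z [^] k) (totatives (ord z))"
    by (rule inj_on_subset) (auto simp: in_totatives_iff)
  have "{x \<in> generate G {z}. ord x = ord z} = (\<lambda>k. z [^] k) ` totatives (ord z)"
  proof (intro equalityI subsetI)
    fix x assume x: "x \<in> {x \<in> generate G {z}. ord x = ord z}"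
    then obtain k :: nat where k: "x = z [^] k" using z mem_generate_iff by blast
    \<comment> \<open>\<open>l\<close> represents \<open>k\<close> modulo \<open>ord z\<close> in
      the range from 1 to \<open>ord z\<close> from which \<open>totatives\<close> are taken;
      residue 0 is moved to \<open>ord z\<close>.\<close>
    define l where "l = (if k mod ord z = 0 then ord z else k mod ord z)"
    have lpos: "l > 0" "l \<le> ord z" using ord_pos[OF z] unfolding l_def by (auto simp: less_imp_le)
    have "int (ord z) dvd int l - int k"
      unfolding l_def by (auto simp: mod_eq_0_iff_dvd zmod_int mod_eq_dvd_iff[symmetric])
    then have xl: "x = z [^] l" using k int_pow_eq[OF z, of "int k" "int l"] by (simp add: int_pow_int)
    then have "coprime l (ord z)" using x pow_ord_eq_ord_iff[OF fin z, of l] by simp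
    then show "x \<in> (\<lambda>k. z [^] k) ` totatives (ord z)" using xl lpos by (auto simp: in_totatives_iff)
  next
    fix x assume "x \<in> (\<lambda>k. z [^] k) ` totatives (ord z)"
    then show "x \<in> {x \<in> generate G {z}. ord x = ord z}"
      using pow_ord_eq_ord_iff[OF fin z] mem_generate_iff z by (auto simp: in_totatives_iff)
  qed
  then show ?thesis using card_image[OF inj] by (simp add: totient_def)
qed

text \<open>All elements of order \<open>d\<close> lie in the one cyclic subgroup of that order and
  are its generators. The count depends on \<open>ord y\<close> alone.\<close>

lemma card_ord_in_generate:
  assumes y: "y \<in> carrier G"
  shows "card {x \<in> generate G {y}. ord x = d} = (if d dvd ord y then totient d else 0)"
proof (cases "d dvd ord y")
  case True
  then obtain z where z: "z \<in> generate G {y}" "ord z = d" using ex_ord_in_generate y by metis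
  have zc: "z \<in> carrier G" using z y generate_closed by blast
  have "{x \<in> generate G {y}. ord x = d} = {x \<in> generate G {z}. ord x = ord z}"
    using mem_generate_iff_ord_dvd[OF y _ z(1)] z generate_trans[OF y _ z(1)] by auto
  then show ?thesis using card_generators[OF zc] z True by simp
next
  case False
  then have "{x \<in> generate G {y}. ord x = d} = {}" using ord_dvd_of_mem_generate y by auto
  then show ?thesis using False by (simp only: card.empty if_False)
qed

end

section \<open>Twin classes of the power graph\<close>

text \<open>Cauchy's theorem: Sylow's theorem with exponent 1 gives a subgroup of order
  \<open>p\<close>, and its elements other than the identity have order \<open>p\<close>.\<close>

lemma (in group) ex_prime_ord:
  assumes "finite (carrier G)" "prime p" "p dvd order G"
  obtains x where "x \<in> carrier G" "ord x = p"
proof -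
  obtain m where "order G = p ^ 1 * m" using assms(3) by (auto elim: dvdE)
  from sylow_thm[OF assms(2) is_group this assms(1)]
  obtain K where K: "subgroup K G" "card K = p" by auto
  have "\<not> K \<subseteq> {\<one>}"
  proof
    assume "K \<subseteq> {\<one>}"
    from card_mono[OF _ this] have "p \<le> 1" using K by simp
    then show False using assms(2) prime_gt_1_nat leD by blast
  qed
  then obtain x where x: "x \<in> K" "x \<noteq> \<one>" by blast
  have xc: "x \<in> carrier G" by (rule subgroup.mem_carrier[OF K(1) x(1)])
  have "ord x dvd p" using ord_dvd_card_subgroup[OF K(1) x(1)] K(2) by simp
  then have "ord x = 1 \<or> ord x = p" using assms(2) by (auto simp: prime_nat_iff)
  then have "ord x = p" using x(2) ord_eq_1[OF xc] by blast
  then show ?thesis using that xc by blast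
qed

context finite_group
begin

abbreviation below (infix "\<preceq>" 50) where
  "x \<preceq> y \<equiv> x \<in> generate G {y}"

text \<open>Adjacency in the power graph made reflexive, so that closed neighbourhoods can be
  compared without excluding the vertex itself.\<close>

definition comparable :: "'a \<Rightarrow> 'a \<Rightarrow> bool" where
  "comparable x y \<longleftrightarrow> x \<preceq> y \<or> y \<preceq> x"

definition twin :: "'a \<Rightarrow> 'a \<Rightarrow> bool" where
  "twin x y \<longleftrightarrow> (\<forall>z\<in>carrier G. comparable x z \<longleftrightarrow> comparable y z)"

definition twins :: "'a \<Rightarrow> 'a set" where
  "twins x = {y \<in> carrier G. twin y x}"

text \<open>This is the twin class of the identity.\<close>

definition dominant :: "'a set" where
  "dominant = {x \<in> carrier G. \<forall>z\<in>carrier G. comparable x z}"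

text \<open>A relation between twin classes rather than elements: it is the part of the direction
  that the undirected graph can reveal, because elements of one class are indistinguishable in
  it.\<close>

definition strictly_below :: "'a \<Rightarrow> 'a \<Rightarrow> bool" where
  "strictly_below x y \<longleftrightarrow> x \<preceq> y \<and> \<not> twin x y"

text \<open>A graph-theoretic trace of an involution: such a \<open>u\<close> is not the identity
  and its class has at least \<open>totient (ord u)\<close> elements, so
  \<open>ord u = 2\<close>.\<close>

definition small_neighbour :: "'a \<Rightarrow> bool" where
  "small_neighbour x \<longleftrightarrow> (\<exists>u\<in>carrier G. u \<notin> dominant \<and> card (twins u) = 1 \<and> comparable u x)"

text \<open>The rank depends only on closed neighbourhoods, so an isomorphism of power graphs transports it, and
  it grows along \<open>strictly_below\<close>.  Two adjacent classes of equal size occur only for orders \<open>m\<close> and \<open>2 m\<close>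
  with \<open>m\<close> odd; there the involution of the larger cyclic group, a twin class of size one, breaks the tie.\<close>
definition rank :: "'a \<Rightarrow> nat" where
  "rank x = (if x \<in> dominant then 0 else 2 * card (twins x) + (if small_neighbour x then 1 else 0))"

text \<open>Exactly when the dominant elements lie below all others; the remaining groups are cyclic.\<close>
definition good :: bool where
  "good \<longleftrightarrow> dominant = {\<one>} \<or> prime_power (order G)"

lemma comparable_sym: "comparable x y \<longleftrightarrow> comparable y x"
  by (auto simp: comparable_def)

lemma comparable_refl: "comparable x x"
  by (simp add: comparable_def generate_refl)

lemma twin_refl: "twin x x" by (simp add: twin_def)
lemma twin_sym: "twin x y \<Longrightarrow> twin y x" by (simp add: twin_def)
lemma twin_trans: "twin x y \<Longrightarrow> twin y z \<Longrightarrow> twin x z" by (simp add: twin_def)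

lemma twins_eq_iff:
  assumes "x \<in> carrier G" "y \<in> carrier G"
  shows "twins x = twins y \<longleftrightarrow> twin x y"
  using assms twin_refl twin_sym twin_trans unfolding twins_def by blast

lemma finite_twins [simp]: "finite (twins x)"
  unfolding twins_def by simp

lemma card_twins_pos: "x \<in> carrier G \<Longrightarrow> card (twins x) > 0"
  using twin_refl by (auto simp: card_gt_0_iff twins_def)

lemma twin_imp_comparable: "y \<in> carrier G \<Longrightarrow> twin x y \<Longrightarrow> comparable x y"
  using comparable_refl unfolding twin_def by blast

lemma below_antisym_twin:
  assumes "x \<in> carrier G" "y \<in> carrier G" "x \<preceq> y" "y \<preceq> x"
  shows "twin x y"
  using assms generate_trans unfolding twin_def comparable_def by meson

lemma below_ord_eq:
  assumes "y \<in> carrier G" "x \<preceq> y" "ord x = ord y"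
  shows "y \<preceq> x"
  using mem_generate_iff_ord_dvd[OF assms(1) generate_refl assms(2)] assms(3) by simp

text \<open>Orders give edges their direction. Inside a twin class, where the graph offers no
  direction, matching orders therefore suffices to match generation.\<close>

lemma comparable_imp_below_iff:
  assumes "x \<in> carrier G" "y \<in> carrier G" "comparable x y"
  shows "x \<preceq> y \<longleftrightarrow> ord x dvd ord y"
  using assms below_ord_eq ord_dvd_of_mem_generate dvd_antisym unfolding comparable_def by metis

lemma one_dominant: "\<one> \<in> dominant"
  unfolding dominant_def comparable_def using one_mem_generate by auto

lemma dominant_twin: "x \<in> dominant \<Longrightarrow> y \<in> dominant \<Longrightarrow> twin x y"
  unfolding dominant_def twin_def by auto

lemma twin_dominant: "x \<in> dominant \<Longrightarrow> y \<in> carrier G \<Longrightarrow> twin x y \<Longrightarrow> y \<in> dominant"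
  unfolding dominant_def twin_def by auto

lemma prime_power_comparable:
  assumes "y \<in> carrier G" "prime_power (ord y)" "a \<preceq> y" "b \<preceq> y"
  shows "comparable a b"
  using prime_power_dvd_total[OF assms(2)] assms ord_dvd_of_mem_generate mem_generate_iff_ord_dvd
  unfolding comparable_def by metis

lemma prime_power_ord:
  assumes "prime_power (order G)" "x \<in> carrier G"
  shows "prime_power (ord x)"
  using assms ord_dvd_group_order prime_power_dvd by blast

text \<open>Every divisor of \<open>ord y\<close> is the order of some element below
  \<open>y\<close>, so comparability with \<open>x\<close> turns into divisibility between that
  divisor and \<open>ord x\<close>, a proper divisor other than 1.\<close>

lemma prime_power_ord_if_all_comparable:
  assumes y: "y \<in> carrier G" and x: "x \<preceq> y" "x \<noteq> \<one>" "ord x \<noteq> ord y"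
    and cmp: "\<And>z. z \<preceq> y \<Longrightarrow> comparable x z"
  shows "prime_power (ord y)"
proof (rule prime_power_if_comparable_divisor)
  have xc: "x \<in> carrier G" using x y generate_closed by blast
  show "ord x dvd ord y" using x y ord_dvd_of_mem_generate by blast
  show "1 < ord x" using ord_gt_1[OF xc x(2)] .
  show "ord x < ord y" using ord_le_of_mem_generate[OF y x(1)] x(3) by simp
  fix d assume "d dvd ord y"
  then obtain z where z: "z \<preceq> y" "ord z = d" using ex_ord_in_generate y by metis
  have "z \<in> carrier G" using z y generate_closed by blast
  then show "d dvd ord x \<or> ord x dvd d"
    using cmp[OF z(1)] z xc ord_dvd_of_mem_generate unfolding comparable_def by blast
qed

lemma twin_prime_power:
  assumes "y \<in> carrier G" "x \<preceq> y" "twin x y" "x \<noteq> \<one>" "ord x \<noteq> ord y"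
  shows "prime_power (ord y)"
proof (rule prime_power_ord_if_all_comparable[OF assms(1,2,4,5)])
  fix z assume "z \<preceq> y"
  then show "comparable x z"
    using assms generate_closed[OF assms(1)] unfolding twin_def comparable_def by blast
qed

text \<open>Convexity of twin classes. If \<open>x\<close> and \<open>y\<close> have equal order,
  then \<open>z\<close> and \<open>y\<close> generate the same subgroup; otherwise
  \<open>ord y\<close> is a prime power and the elements below \<open>y\<close> form a chain. The
  hypothesis \<open>good\<close> enters when \<open>x = \<one>\<close>: in a cyclic group of other
  order, a generator is a twin of the identity, but the elements strictly between are not.\<close>

lemma twin_between:
  assumes good: good and y: "y \<in> carrier G" and xz: "x \<preceq> z" and zy: "z \<preceq> y" and tw: "twin x y"
  shows "twin z y"
proof -
  have zc: "z \<in> carrier G" using zy y generate_closed by blast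
  have xc: "x \<in> carrier G" using xz zc generate_closed by blast
  have xy: "x \<preceq> y" using generate_trans xz zy y by blast
  show ?thesis
  proof (cases "ord x = ord y")
    case True
    then have "y \<preceq> x" using below_ord_eq xy y by blast
    then have "y \<preceq> z" using generate_trans zc xz by blast
    then show ?thesis using below_antisym_twin zc y zy by blast
  next
    case False
    have pp: "prime_power (ord y)"
    proof (cases "x = \<one>")
      case True
      then have "y \<in> dominant" using one_dominant twin_dominant tw y by blast
      moreover have "y \<noteq> \<one>" using False True by auto
      ultimately have "prime_power (order G)" using good unfolding good_def by blast
      then show ?thesis using prime_power_ord y by blast
    next
      case xn: False
      then show ?thesis using twin_prime_power y xy tw False by blast
    qed
    show ?thesis unfolding twin_def
    proof (intro ballI iffI)
      fix w assume w: "w \<in> carrier G" "comparable z w"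
      then have "w \<preceq> y \<or> z \<preceq> w" using generate_trans y zy unfolding comparable_def by blast
      then show "comparable y w"
      proof
        assume "z \<preceq> w"
        then have "comparable x w" using generate_trans w xz unfolding comparable_def by blast
        then show ?thesis using tw w unfolding twin_def by blast
      qed (simp add: comparable_def)
    next
      fix w assume w: "w \<in> carrier G" "comparable y w"
      show "comparable z w"
      proof (cases "w \<preceq> y")
        case True
        then show ?thesis using prime_power_comparable[OF y pp zy] by blast
      next
        case False
        then have "y \<preceq> w" using w unfolding comparable_def by blast
        then show ?thesis using generate_trans w zy unfolding comparable_def by blast
      qed
    qed
  qed
qed

text \<open>Being a twin of \<open>x\<close>, the element \<open>x'\<close> is comparable with
  \<open>y\<close>. The wrong direction \<open>y \<preceq> x'\<close> would place \<open>y\<close>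
  between two twins, and convexity would make it their twin.\<close>

lemma strictly_below_twin_left:
  assumes good and c: "x \<in> carrier G" "x' \<in> carrier G" "y \<in> carrier G"
    and sb: "strictly_below x y" and tw: "twin x x'"
  shows "strictly_below x' y"
proof -
  have "comparable x' y" using sb tw c unfolding strictly_below_def twin_def comparable_def by blast
  moreover have "\<not> y \<preceq> x'"
  proof
    assume "y \<preceq> x'"
    then have "twin y x'" using twin_between[OF \<open>good\<close> c(2) _ _ tw] sb
      unfolding strictly_below_def by blast
    then show False using sb tw twin_sym twin_trans unfolding strictly_below_def by blast
  qed
  ultimately show ?thesis
    using sb tw twin_trans unfolding strictly_below_def comparable_def by blast
qed

lemma strictly_below_twin_right:
  assumes good and c: "x \<in> carrier G" "y \<in> carrier G" "y' \<in> carrier G"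
    and sb: "strictly_below x y" and tw: "twin y y'"
  shows "strictly_below x y'"
proof -
  have "comparable x y'" using sb tw c comparable_sym unfolding strictly_below_def twin_def comparable_def by blast
  moreover have "\<not> y' \<preceq> x"
  proof
    assume "y' \<preceq> x"
    then have "twin x y" using twin_between[OF \<open>good\<close> c(2) _ _ twin_sym[OF tw]] sb
      unfolding strictly_below_def by blast
    then show False using sb unfolding strictly_below_def by blast
  qed
  ultimately show ?thesis
    using sb tw twin_trans twin_sym unfolding strictly_below_def comparable_def by blast
qed

lemma strictly_below_cong:
  assumes good "x \<in> carrier G" "x' \<in> carrier G" "y \<in> carrier G" "y' \<in> carrier G"
    "twin x x'" "twin y y'"
  shows "strictly_below x y \<longleftrightarrow> strictly_below x' y'"
  using assms strictly_below_twin_left strictly_below_twin_right twin_sym by metis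

text \<open>Twins are pairwise comparable, so an element of largest order in the class generates all
  the others.\<close>

lemma ex_top_twin:
  assumes x: "x \<in> carrier G"
  obtains y where "y \<in> twins x" "\<And>z. z \<in> twins x \<Longrightarrow> z \<preceq> y"
proof -
  have "x \<in> twins x" using x twin_refl by (simp add: twins_def)
  then have "Max (ord ` twins x) \<in> ord ` twins x" by (intro Max_in) auto
  then obtain y where y: "y \<in> twins x" and "ord y = Max (ord ` twins x)" by auto
  then have ymax: "ord z \<le> ord y" if "z \<in> twins x" for z using that by simp
  have "z \<preceq> y" if z: "z \<in> twins x" for z
  proof -
    have c: "z \<in> carrier G" "y \<in> carrier G" "twin z y"
      using z y twin_sym twin_trans unfolding twins_def by blast+
    then have cmp: "comparable z y" using twin_imp_comparable by blast
    then show ?thesis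
    proof (cases "y \<preceq> z")
      case True
      then have "ord y = ord z" using ymax[OF z] ord_le_of_mem_generate c by (metis le_antisym)
      then show ?thesis using True below_ord_eq c by blast
    qed (auto simp: comparable_def)
  qed
  then show ?thesis using that y by blast
qed

text \<open>So its size and the order of its maximum determine how many elements of each order a twin class has.\<close>
lemma twins_eq_top_segment:
  assumes good and y: "y \<in> carrier G" and top: "\<And>z. z \<in> twins y \<Longrightarrow> z \<preceq> y"
  shows "twins y = {x \<in> generate G {y}. ord y < ord x + card (twins y)}"
proof -
  let ?C = "generate G {y}"
  have finC: "finite ?C" using finite_generate y by blast
  have sub: "twins y \<subseteq> ?C" using top by blast
  have diff: "card (?C - twins y) + card (twins y) = ord y"
    using sub finC card_Diff_subset[OF finite_twins sub] card_mono[OF finC sub] card_generate[OF y]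
    by simp
  have "x \<in> twins y \<longleftrightarrow> ord y < ord x + card (twins y)" if x: "x \<in> ?C" for x
  proof
    have xc: "x \<in> carrier G" using x y generate_closed by blast
    assume tx: "x \<in> twins y"
    \<comment> \<open>By convexity, whatever lies below \<open>y\<close> outside the class also lies
      below each member \<open>x\<close> of the class. Hence \<open>ord x\<close> exceeds the number
      \<open>ord y - card (twins y)\<close> of such elements.\<close>
    have "?C - twins y \<subset> generate G {x}"
    proof
      show "?C - twins y \<subseteq> generate G {x}"
      proof
        fix z assume z: "z \<in> ?C - twins y"
        then have zc: "z \<in> carrier G" using y generate_closed by blast
        have "comparable x z" using tx z zc unfolding twins_def twin_def comparable_def by blast
        moreover have "\<not> x \<preceq> z"
          using twin_between[OF \<open>good\<close> y, of x z] z tx zc unfolding twins_def by blast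
        ultimately show "z \<in> generate G {x}" by (simp add: comparable_def)
      qed
      show "?C - twins y \<noteq> generate G {x}" using tx generate_refl by blast
    qed
    then have "card (?C - twins y) < ord x"
      using psubset_card_mono finite_generate xc card_generate by metis
    then show "ord y < ord x + card (twins y)" using diff by simp
  next
    have xc: "x \<in> carrier G" using x y generate_closed by blast
    assume less: "ord y < ord x + card (twins y)"
    show "x \<in> twins y"
    proof (rule ccontr)
      assume nx: "x \<notin> twins y"
      \<comment> \<open>For \<open>x\<close> outside the class, convexity keeps everything below
        \<open>x\<close> outside as well, which bounds \<open>ord x\<close> by the same
        number.\<close>
      have "generate G {x} \<subseteq> ?C - twins y"
      proof
        fix z assume z: "z \<preceq> x"
        have "z \<notin> twins y"
          using twin_between[OF \<open>good\<close> y z x] nx xc unfolding twins_def by blast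
        then show "z \<in> ?C - twins y" using generate_trans[OF y z x] by blast
      qed
      then have "ord x \<le> card (?C - twins y)"
        using card_mono finC card_generate[OF xc] by (metis finite_Diff)
      then show False using less diff by simp
    qed
  qed
  then show ?thesis using sub by blast
qed

text \<open>The right-hand side uses only relations that an isomorphism of power graphs preserves,
  so the cardinality of the left-hand side, the order of a top element, becomes an invariant of the
  class.\<close>

lemma generate_top_eq:
  assumes good and y: "y \<in> carrier G" and top: "\<And>z. z \<in> twins y \<Longrightarrow> z \<preceq> y"
  shows "generate G {y} = {x \<in> carrier G. twin x y \<or> strictly_below x y}"
  using top generate_closed[OF y] unfolding strictly_below_def twins_def by auto

end

section \<open>Sizes of twin classes along the order, and the rank\<close>

context finite_group
begin

text \<open>Under \<open>good\<close>, either only the identity is dominant or the elements below a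
  dominant one form a chain. In the exceptional cyclic groups generators are dominant while elements
  below them are not.\<close>

lemma dominant_down:
  assumes good "x \<in> carrier G" "y \<in> dominant" "x \<preceq> y"
  shows "x \<in> dominant"
proof (cases "dominant = {\<one>}")
  case True
  then show ?thesis using assms by (auto simp: generate_one)
next
  case False
  then have "prime_power (order G)" using assms unfolding good_def by blast
  then have pp: "prime_power (ord y)" and y: "y \<in> carrier G"
    using assms prime_power_ord unfolding dominant_def by auto
  have "comparable x w" if w: "w \<in> carrier G" for w
  proof (cases "w \<preceq> y")
    case True
    then show ?thesis using prime_power_comparable[OF y pp] assms by blast
  next
    case False
    then have "y \<preceq> w" using assms w unfolding dominant_def comparable_def by blast
    then show ?thesis using generate_trans[OF w] assms unfolding comparable_def by blast
  qed
  then show ?thesis using assms unfolding dominant_def by blast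
qed

lemma totient_le_card_twins:
  assumes "y \<in> carrier G"
  shows "totient (ord y) \<le> card (twins y)"
proof -
  have "{x \<in> generate G {y}. ord x = ord y} \<subseteq> twins y"
    unfolding twins_def using generate_closed below_antisym_twin below_ord_eq assms by blast
  then show ?thesis using card_mono[OF finite_twins] card_generators[OF assms] by metis
qed

text \<open>The orders of \<open>u\<close> and \<open>x\<close> are coprime and exceed 1, so these
  two are not comparable. Another twin \<open>v\<close> of \<open>u\<close> would lie above
  \<open>u\<close> and have order a power of 2 greater than 2. Comparability of \<open>v\<close>
  with \<open>y\<close> then fails: \<open>ord v\<close> does not divide twice an odd number, and
  the odd \<open>ord x > 1\<close> does not divide a power of 2.\<close>

lemma card_twins_involution:
  assumes x: "x \<in> carrier G" "x \<noteq> \<one>" "odd (ord x)"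
    and y: "y \<in> carrier G" "x \<preceq> y" "ord y = 2 * ord x" and u: "u \<preceq> y" "ord u = 2"
  shows "u \<notin> dominant" "card (twins u) = 1"
proof -
  have uc: "u \<in> carrier G" using u y generate_closed by blast
  have gt: "ord x > 1" using ord_gt_1 x by blast
  have "\<not> comparable u x"
  proof
    assume "comparable u x"
    then have "2 dvd ord x \<or> ord x dvd 2"
      using ord_dvd_of_mem_generate[OF uc, of x] ord_dvd_of_mem_generate[OF x(1), of u] u
      unfolding comparable_def by auto
    then show False using x(3) gt dvd_imp_le[of "ord x" 2] by (auto simp: le_Suc_eq numeral_2_eq_2)
  qed
  then show nd: "u \<notin> dominant" using x unfolding dominant_def by blast
  have "v = u" if v: "v \<in> twins u" for v
  proof (rule ccontr)
    assume ne: "v \<noteq> u"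
    have vc: "v \<in> carrier G" and tw: "twin v u" using v unfolding twins_def by auto
    have v1: "v \<noteq> \<one>" using tw nd one_dominant twin_dominant uc by blast
    have gu: "generate G {u} = {\<one>, u}"
    proof -
      have u1: "u \<noteq> \<one>" using u ord_eq_1 by auto
      have "card {\<one>, u} = card (generate G {u})" using u1 u card_generate[OF uc] by simp
      moreover have "{\<one>, u} \<subseteq> generate G {u}" using one_mem_generate generate_refl by blast
      ultimately show ?thesis using card_subset_eq finite_generate[OF uc] by metis
    qed
    have uv: "u \<preceq> v" using twin_imp_comparable[OF uc tw] gu ne v1 unfolding comparable_def by blast
    have ov: "ord u \<noteq> ord v" using below_ord_eq[OF vc uv] gu ne v1 by auto
    have u1: "u \<noteq> \<one>" using u ord_eq_1 by auto
    obtain p k where pk: "prime p" "ord v = p ^ k"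
      using twin_prime_power[OF vc uv twin_sym[OF tw] u1 ov] unfolding prime_power_def by blast
    have "2 dvd ord v" using ord_dvd_of_mem_generate[OF vc uv] u by simp
    then have "2 dvd p" using pk by simp
    then have p2: "p = 2" using pk by (metis primes_dvd_imp_eq two_is_prime_nat)
    have cop: "coprime (ord v) (ord x)" using x pk p2 by simp
    have "comparable v y" using tw y u unfolding twin_def comparable_def by blast
    then show False unfolding comparable_def
    proof
      assume "v \<preceq> y"
      then have "ord v dvd 2 * ord x" using ord_dvd_of_mem_generate y by metis
      then have "ord v dvd 2" using cop by (simp add: coprime_dvd_mult_left_iff)
      then show False using \<open>2 dvd ord v\<close> ov u dvd_antisym by metis
    next
      assume "y \<preceq> v"
      then have "ord x dvd ord v" using ord_dvd_of_mem_generate[OF vc] y(3) by (metis dvd_mult_right)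
      then show False using cop gt by (metis coprime_absorb_right nat_dvd_1_iff_1 nat_neq_iff)
    qed
  qed
  moreover have "u \<in> twins u" using uc twin_refl by (simp add: twins_def)
  ultimately have "twins u = {u}" by blast
  then show "card (twins u) = 1" by simp
qed

text \<open>The witness \<open>u\<close> would have order 2, since a larger order gives more than
  one generator and hence a larger class. An involution is not comparable with an element of odd
  order greater than 1.\<close>

lemma not_small_neighbour_odd:
  assumes x: "x \<in> carrier G" "x \<noteq> \<one>" "odd (ord x)"
  shows "\<not> small_neighbour x"
proof
  assume "small_neighbour x"
  then obtain u where u: "u \<in> carrier G" "u \<notin> dominant" "card (twins u) = 1" "comparable u x"
    unfolding small_neighbour_def by blast
  have gt: "ord x > 1" using ord_gt_1 x by blast
  have "u \<noteq> \<one>" using u one_dominant by blast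
  then have gtu: "ord u > 1" using ord_gt_1 u by blast
  have "\<not> ord u > 2"
  proof
    assume "ord u > 2"
    then have "totient (ord u) > 1" by (rule totient_gt_1)
    then show False using totient_le_card_twins[OF u(1)] u by simp
  qed
  then have "ord u = 2" using gtu by simp
  moreover have "ord u dvd ord x \<or> ord x dvd ord u"
    using u x ord_dvd_of_mem_generate unfolding comparable_def by blast
  moreover have "ord x \<noteq> 2" using x by auto
  ultimately show False using x(3) gt dvd_imp_le[of "ord x" 2] by auto
qed

text \<open>Let \<open>t\<close> be a top element of the class of \<open>x\<close>. If all members
  have the same order, the class consists of the generators of one cyclic subgroup and has
  \<open>totient (ord t)\<close> elements, at most as many as the class of \<open>y\<close>; a tie
  forces \<open>ord y = 2 * ord t\<close> with \<open>ord t\<close> odd, and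
  \<open>small_neighbour\<close> decides. If orders vary, \<open>ord t\<close> and then
  \<open>ord y\<close> are powers of one prime, and the class of \<open>x\<close> has fewer than
  \<open>ord t\<close> elements, while \<open>ord t\<close> is at most
  \<open>totient (ord y)\<close>.\<close>

lemma rank_less:
  assumes good and x: "x \<in> carrier G" and y: "y \<in> carrier G" and sb: "strictly_below x y"
  shows "rank x < rank y"
proof -
  have xy: "x \<preceq> y" and nt: "\<not> twin x y" using sb unfolding strictly_below_def by auto
  show ?thesis
  proof (cases "x \<in> dominant")
    case True
    then have "y \<notin> dominant" using nt dominant_twin by blast
    then show ?thesis using True card_twins_pos[OF y] by (simp add: rank_def)
  next
    case xd: False
    then have yd: "y \<notin> dominant" using dominant_down[OF \<open>good\<close> x _ xy] by blast
    obtain t where t: "t \<in> twins x" "\<And>z. z \<in> twins x \<Longrightarrow> z \<preceq> t" using ex_top_twin[OF x] by blast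
    have tc: "t \<in> carrier G" and tx: "twin t x" using t unfolding twins_def by auto
    have td: "t \<notin> dominant" using xd tx twin_dominant x by blast
    have sbt: "strictly_below t y" using strictly_below_twin_left[OF \<open>good\<close> x tc y sb] tx twin_sym by blast
    then have ty: "t \<preceq> y" and ntt: "\<not> twin t y" unfolding strictly_below_def by auto
    have ord_ne: "ord t \<noteq> ord y" using below_ord_eq[OF y ty] below_antisym_twin tc y ty ntt by blast
    have dv: "ord t dvd ord y" using ord_dvd_of_mem_generate[OF y ty] .
    have t1: "t \<noteq> \<one>" using td one_dominant by blast
    show ?thesis
    proof (cases "\<forall>z\<in>twins x. ord z = ord t")
      case True
      have "twins x = {z \<in> generate G {t}. ord z = ord t}"
      proof (intro equalityI subsetI)
        fix z assume "z \<in> twins x" then show "z \<in> {z \<in> generate G {t}. ord z = ord t}"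
          using True t by blast
      next
        fix z assume z: "z \<in> {z \<in> generate G {t}. ord z = ord t}"
        then have "z \<in> carrier G" "twin z t"
          using tc generate_closed below_ord_eq below_antisym_twin by blast+
        then show "z \<in> twins x" using tx twin_trans unfolding twins_def by blast
      qed
      then have cx: "card (twins x) = totient (ord t)" using card_generators[OF tc] by simp
      have le: "totient (ord t) \<le> totient (ord y)" using totient_dvd_mono dv ord_pos[OF y] by blast
      have cy: "totient (ord y) \<le> card (twins y)" using totient_le_card_twins[OF y] .
      show ?thesis
      proof (cases "card (twins x) < card (twins y)")
        case True
        then show ?thesis using xd yd by (simp add: rank_def)
      next
        case False
        then have eq: "totient (ord t) = totient (ord y)" "card (twins x) = card (twins y)"
          using cx le cy by auto
        have dbl: "ord y = 2 * ord t" "odd (ord t)"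
          using totient_eq_imp_double[OF dv ord_pos[OF y] ord_ne eq(1)] by auto
        obtain u where u: "u \<preceq> y" "ord u = 2" using ex_ord_in_generate[OF y, of 2] dbl by auto
        have "small_neighbour y"
          using card_twins_involution[OF tc t1 dbl(2) y ty dbl(1) u] u generate_closed[OF y]
          unfolding small_neighbour_def comparable_def by blast
        moreover have "\<not> small_neighbour x"
        proof -
          have "x \<noteq> \<one>" using xd one_dominant by blast
          moreover have "x \<in> twins x" using x twin_refl by (simp add: twins_def)
          ultimately show ?thesis using not_small_neighbour_odd[OF x] True dbl by metis
        qed
        ultimately show ?thesis using xd yd eq by (simp add: rank_def)
      qed
    next
      case False
      then obtain z where z: "z \<in> twins x" "ord z \<noteq> ord t" by blast
      have zc: "z \<in> carrier G" and zx: "twin z x" using z unfolding twins_def by auto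
      have zt: "z \<preceq> t" using t z by blast
      have z1: "z \<noteq> \<one>" using zx xd one_dominant twin_dominant x by blast
      have tw: "twin z t" using zx tx twin_sym twin_trans by blast
      have ppt: "prime_power (ord t)" using twin_prime_power[OF tc zt tw z1 z(2)] .
      have zt_dvd: "ord z dvd ord t" using ord_dvd_of_mem_generate[OF tc zt] .
      have ppy: "prime_power (ord y)"
      proof -
        obtain p k where pk: "prime p" "ord t = p ^ k" using ppt unfolding prime_power_def by blast
        have "q = p" if q: "prime q" "q dvd ord y" for q
        proof (rule ccontr)
          assume qp: "q \<noteq> p"
          obtain i where i: "ord z = p ^ i" "i \<le> k" using zt_dvd pk divides_primepow_nat by metis
          then have ik: "i < k" using z pk by (metis le_neq_implies_less)
          have cop: "coprime (p ^ j) q" for j using q pk qp by (simp add: primes_coprime)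
          have "p ^ i dvd ord y" using dv zt_dvd i dvd_trans by metis
          then have "p ^ i * q dvd ord y" using q cop by (simp add: divides_mult)
          \<comment> \<open>A second prime \<open>q\<close> would yield \<open>w\<close> above
            \<open>z\<close> but incomparable with \<open>t\<close>: its order lacks the power of
            \<open>p\<close> in \<open>ord t\<close> and has the foreign factor \<open>q\<close>.
            This separates the twins \<open>z\<close> and \<open>t\<close>.\<close>
          then obtain w where w: "w \<preceq> y" "ord w = p ^ i * q" using ex_ord_in_generate y by metis
          have wc: "w \<in> carrier G" using w y generate_closed by blast
          have "z \<preceq> y" using generate_trans[OF y zt ty] .
          then have "z \<preceq> w" using mem_generate_iff_ord_dvd[OF y _ w(1)] w i by simp
          then have "comparable t w" using tw wc unfolding twin_def comparable_def by blast
          then have "ord t dvd ord w \<or> ord w dvd ord t"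
            using tc wc ord_dvd_of_mem_generate unfolding comparable_def by blast
          then show False
          proof
            assume "ord t dvd ord w"
            then have "p ^ k dvd p ^ i" using w pk cop by (simp add: coprime_dvd_mult_left_iff)
            then show False using ik pk by (metis dvd_power_iff_le leD prime_ge_2_nat)
          next
            assume "ord w dvd ord t"
            then have "q dvd p ^ k" using w pk by (metis dvd_mult_right)
            then show False using q qp pk by (metis prime_dvd_power primes_dvd_imp_eq)
          qed
        qed
        then show ?thesis using prime_power_if_unique_prime ord_pos[OF y] by metis
      qed
      have "ord t \<le> totient (ord y)"
      proof -
        obtain p k where pk: "prime p" "ord y = p ^ k" using ppy unfolding prime_power_def by blast
        obtain i where i: "ord t = p ^ i" "i \<le> k" using dv pk divides_primepow_nat by metis
        have "i < k" using i pk ord_ne by (metis le_neq_implies_less)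
        then have "totient (ord y) = p ^ (k - 1) * (p - 1)" using pk totient_prime_power[OF pk(1)] by simp
        moreover have "p ^ i \<le> p ^ (k - 1)" using \<open>i < k\<close> prime_gt_0_nat[OF pk(1)]
          by (intro power_increasing) auto
        moreover have "p - 1 \<ge> 1" using prime_ge_2_nat[OF pk(1)] by simp
        ultimately show ?thesis using i by (metis le_trans mult_le_mono nat_mult_1_right)
      qed
      moreover have "card (twins x) < ord t"
      proof -
        have "\<one> \<notin> twins x" using xd one_dominant twin_dominant x unfolding twins_def by blast
        then have "twins x \<subset> generate G {t}" using t one_mem_generate by blast
        then show ?thesis using psubset_card_mono[OF finite_generate[OF tc]] card_generate[OF tc] by metis
      qed
      ultimately have "card (twins x) < card (twins y)" using totient_le_card_twins[OF y] by linarith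
      then show ?thesis using xd yd by (simp add: rank_def)
    qed
  qed
qed

text \<open>The right-hand side is expressed by closed neighbourhoods alone, so the order between
  twin classes can be read off from the undirected graph.\<close>

lemma strictly_below_iff_rank:
  assumes good "x \<in> carrier G" "y \<in> carrier G"
  shows "strictly_below x y \<longleftrightarrow> comparable x y \<and> \<not> twin x y \<and> rank x < rank y"
proof
  assume "strictly_below x y"
  then show "comparable x y \<and> \<not> twin x y \<and> rank x < rank y"
    using rank_less assms unfolding strictly_below_def comparable_def by blast
next
  assume r: "comparable x y \<and> \<not> twin x y \<and> rank x < rank y"
  have "\<not> y \<preceq> x"
  proof
    assume "y \<preceq> x"
    then have "strictly_below y x" using r twin_sym unfolding strictly_below_def by blast
    then show False using rank_less assms r by (meson less_asym)
  qed
  then show "strictly_below x y" using r unfolding strictly_below_def comparable_def by blast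
qed

end

section \<open>From power graphs to directed power graphs\<close>

lemma bij_betw_of_card_fibres:
  assumes "finite A" "finite B"
    and card: "\<And>k. card {a \<in> A. c a = k} = card {b \<in> B. c' b = k}"
  shows "\<exists>g. bij_betw g A B \<and> (\<forall>a\<in>A. c' (g a) = c a)"
proof -
  have "\<exists>h. bij_betw h {a \<in> A. c a = k} {b \<in> B. c' b = k}" for k
    using card[of k] assms(1,2) by (intro finite_same_card_bij) auto
  then obtain h where h: "\<And>k. bij_betw (h k) {a \<in> A. c a = k} {b \<in> B. c' b = k}" by metis
  have img: "h (c a) a \<in> B \<and> c' (h (c a) a) = c a" if "a \<in> A" for a
    using bij_betwE[OF h[of "c a"]] that by blast
  have "bij_betw (\<lambda>a. h (c a) a) A B"
  proof (rule bij_betw_imageI)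
    show "inj_on (\<lambda>a. h (c a) a) A"
    proof (rule inj_onI)
      fix a b assume ab: "a \<in> A" "b \<in> A" "h (c a) a = h (c b) b"
      then have "c a = c b" using img by metis
      then show "a = b" using bij_betw_imp_inj_on[OF h[of "c a"]] ab unfolding inj_on_def by auto
    qed
    show "(\<lambda>a. h (c a) a) ` A = B"
    proof (intro equalityI subsetI)
      fix b assume "b \<in> B"
      then have "b \<in> h (c' b) ` {a \<in> A. c a = c' b}"
        using bij_betw_imp_surj_on[OF h[of "c' b"]] by blast
      then obtain a where a: "b = h (c' b) a" "a \<in> {a \<in> A. c a = c' b}" by (rule imageE)
      then have "b = h (c a) a" by simp
      then show "b \<in> (\<lambda>a. h (c a) a) ` A" using a(2) by (intro image_eqI[where x = a]) simp_all
    qed (use img in blast)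
  qed
  then show ?thesis using img by blast
qed

definition directed_power_iso :: "('a, 'b) monoid_scheme \<Rightarrow> ('c, 'd) monoid_scheme \<Rightarrow> ('a \<Rightarrow> 'c) \<Rightarrow> bool" where
  "directed_power_iso G H g \<longleftrightarrow> bij_betw g (carrier G) (carrier H) \<and>
     (\<forall>x\<in>carrier G. \<forall>y\<in>carrier G. x \<in> generate G {y} \<longleftrightarrow> g x \<in> generate H {g y})"

lemma (in finite_group) power_adj_iff: "power_adj G x y \<longleftrightarrow> x \<noteq> y \<and> comparable x y"
  by (auto simp: power_adj_def comparable_def)

text \<open>Take a dominant \<open>x\<close> other than the identity. If \<open>ord x\<close> were a
  power of \<open>p\<close>, comparability with the elements of prime order given by Cauchy's
  theorem would leave \<open>p\<close> as the only prime divisor of the group order. So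
  \<open>ord x\<close> is not a prime power; but an element properly above \<open>x\<close> would
  have prime power order, hence everything lies below \<open>x\<close>.\<close>

lemma (in finite_group) not_good_imp_cyclic:
  assumes "\<not> good"
  obtains x where "x \<in> carrier G" "carrier G = generate G {x}"
proof -
  have npp: "\<not> prime_power (order G)" using assms by (simp add: good_def)
  have "dominant \<noteq> {\<one>}" using assms by (auto simp: good_def)
  then obtain x where x: "x \<in> dominant" "x \<noteq> \<one>" using one_dominant by blast
  have xc: "x \<in> carrier G" using x by (simp add: dominant_def)
  have cmp: "comparable x w" if "w \<in> carrier G" for w using x that by (simp add: dominant_def)
  have above: "prime_power (ord w)" if w: "w \<in> carrier G" "x \<preceq> w" "ord x \<noteq> ord w" for w
    by (rule prime_power_ord_if_all_comparable[OF w(1,2) x(2) w(3)])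
      (rule cmp, rule generate_closed[OF w(1)])
  have npx: "\<not> prime_power (ord x)"
  proof
    assume "prime_power (ord x)"
    then obtain p k where pk: "prime p" "ord x = p ^ k" unfolding prime_power_def by blast
    have "q = p" if q: "prime q" "q dvd order G" for q
    proof -
      obtain w where w: "w \<in> carrier G" "ord w = q" using ex_prime_ord[OF fin q] by blast
      show ?thesis
      proof (cases "w \<preceq> x")
        case True
        then have "q dvd p ^ k" using ord_dvd_of_mem_generate[OF xc True] w pk by simp
        then show ?thesis using q pk by (meson prime_dvd_power primes_dvd_imp_eq)
      next
        case False
        then have "ord x dvd q" using cmp[OF w(1)] ord_dvd_of_mem_generate[OF w(1)] w
          unfolding comparable_def by blast
        then have "ord x = q" using ord_gt_1[OF xc x(2)] q by (auto simp: prime_nat_iff)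
        then show ?thesis using pk q by (metis prime_dvd_power primes_dvd_imp_eq dvd_refl)
      qed
    qed
    moreover have "order G > 0" using fin by (simp add: order_gt_0_iff_finite)
    ultimately show False using prime_power_if_unique_prime npp by blast
  qed
  have "w \<preceq> x" if w: "w \<in> carrier G" for w
  proof (rule ccontr)
    assume nw: "\<not> w \<preceq> x"
    then have xw: "x \<preceq> w" using cmp[OF w] by (simp add: comparable_def)
    then have "ord x \<noteq> ord w" using below_ord_eq[OF w] nw by blast
    then have "prime_power (ord w)" using above w xw by blast
    then show False using prime_power_dvd ord_dvd_of_mem_generate[OF w xw] npx by blast
  qed
  then have "carrier G = generate G {x}" using generate_closed[OF xc] by blast
  then show ?thesis using that xc by blast
qed

section \<open>Invariants carried along an isomorphism of power graphs\<close>

locale power_graph_isomorphism = G: finite_group G + H: finite_group H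
  for G :: "('a, 'b) monoid_scheme" (structure) and H :: "('c, 'd) monoid_scheme" (structure) +
  fixes f :: "'a \<Rightarrow> 'c"
  assumes bij: "bij_betw f (carrier G) (carrier H)"
    and adj: "\<And>x y. x \<in> carrier G \<Longrightarrow> y \<in> carrier G \<Longrightarrow> power_adj G x y \<longleftrightarrow> power_adj H (f x) (f y)"
begin

lemma f_closed: "x \<in> carrier G \<Longrightarrow> f x \<in> carrier H"
  using bij bij_betwE by blast

lemma f_inj: "x \<in> carrier G \<Longrightarrow> y \<in> carrier G \<Longrightarrow> f x = f y \<longleftrightarrow> x = y"
  using bij unfolding bij_betw_def inj_on_def by blast

lemma f_surj: "z \<in> carrier H \<Longrightarrow> \<exists>x\<in>carrier G. z = f x"
  using bij unfolding bij_betw_def by blast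

lemma ball_carrier_H: "(\<forall>z\<in>carrier H. P z) \<longleftrightarrow> (\<forall>x\<in>carrier G. P (f x))"
  using f_closed f_surj by blast

lemma order_eq: "order H = order G"
  using bij_betw_same_card[OF bij] by (simp add: order_def)

lemma card_image_f: "A \<subseteq> carrier G \<Longrightarrow> card (f ` A) = card A"
  using bij by (metis bij_betw_imp_inj_on card_image inj_on_subset)

lemma comparable_f:
  "x \<in> carrier G \<Longrightarrow> y \<in> carrier G \<Longrightarrow> H.comparable (f x) (f y) \<longleftrightarrow> G.comparable x y"
  using adj G.power_adj_iff H.power_adj_iff f_inj G.comparable_refl H.comparable_refl by metis

lemma twin_f: "x \<in> carrier G \<Longrightarrow> y \<in> carrier G \<Longrightarrow> H.twin (f x) (f y) \<longleftrightarrow> G.twin x y"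
  unfolding G.twin_def H.twin_def ball_carrier_H by (simp add: comparable_f)

lemma Collect_carrier_H:
  assumes "\<And>x. x \<in> carrier G \<Longrightarrow> P (f x) \<longleftrightarrow> Q x"
  shows "{z \<in> carrier H. P z} = f ` {x \<in> carrier G. Q x}"
proof (intro equalityI subsetI)
  fix z assume z: "z \<in> {z \<in> carrier H. P z}"
  then obtain x where "x \<in> carrier G" "z = f x" using f_surj by blast
  then show "z \<in> f ` {x \<in> carrier G. Q x}" using z assms by blast
next
  fix z assume "z \<in> f ` {x \<in> carrier G. Q x}"
  then show "z \<in> {z \<in> carrier H. P z}" using assms f_closed by blast
qed

lemma twins_f: "x \<in> carrier G \<Longrightarrow> H.twins (f x) = f ` G.twins x"
  unfolding G.twins_def H.twins_def by (rule Collect_carrier_H) (rule twin_f)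

lemma dominant_f: "x \<in> carrier G \<Longrightarrow> f x \<in> H.dominant \<longleftrightarrow> x \<in> G.dominant"
  unfolding G.dominant_def H.dominant_def ball_carrier_H mem_Collect_eq
  by (simp add: comparable_f f_closed)

lemma dominant_image: "H.dominant = f ` G.dominant"
proof -
  have "G.dominant \<subseteq> carrier G" "H.dominant \<subseteq> carrier H"
    by (auto simp: G.dominant_def H.dominant_def)
  then show ?thesis using dominant_f f_surj by blast
qed

lemma card_twins_f: "x \<in> carrier G \<Longrightarrow> card (H.twins (f x)) = card (G.twins x)"
  unfolding twins_f by (rule card_image_f) (auto simp: G.twins_def)

lemma bex_carrier_H: "(\<exists>z\<in>carrier H. P z) \<longleftrightarrow> (\<exists>x\<in>carrier G. P (f x))"
  using f_closed f_surj by blast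

lemma small_neighbour_f: "x \<in> carrier G \<Longrightarrow> H.small_neighbour (f x) \<longleftrightarrow> G.small_neighbour x"
  unfolding G.small_neighbour_def H.small_neighbour_def bex_carrier_H
  by (simp add: comparable_f card_twins_f dominant_f cong: bex_cong)

lemma rank_f: "x \<in> carrier G \<Longrightarrow> H.rank (f x) = G.rank x"
  unfolding G.rank_def H.rank_def by (simp add: small_neighbour_f card_twins_f dominant_f)

lemma good_f: "H.good \<longleftrightarrow> G.good"
proof -
  \<comment> \<open>\<open>f\<close> need not send the identity to the identity, so the condition is
    put in terms of cardinality.\<close>
  have "G.dominant = {\<one>\<^bsub>G\<^esub>} \<longleftrightarrow> card G.dominant = 1"
    using G.one_dominant by (auto simp: card_1_singleton_iff)
  moreover have "H.dominant = {\<one>\<^bsub>H\<^esub>} \<longleftrightarrow> card H.dominant = 1"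
    using H.one_dominant by (auto simp: card_1_singleton_iff)
  moreover have "card H.dominant = card G.dominant"
    unfolding dominant_image by (rule card_image_f) (auto simp: G.dominant_def)
  ultimately show ?thesis unfolding G.good_def H.good_def by (simp add: order_eq)
qed

lemma strictly_below_f:
  assumes "G.good" "x \<in> carrier G" "y \<in> carrier G"
  shows "H.strictly_below (f x) (f y) \<longleftrightarrow> G.strictly_below x y"
  using G.strictly_below_iff_rank[OF assms] H.strictly_below_iff_rank[of "f x" "f y"] assms
  by (simp add: good_f comparable_f twin_f rank_f f_closed)

text \<open>\<open>f\<close> does not preserve orders of single elements, only these counts. It maps
  the set below a top element of the class in \<open>G\<close> onto the set below a top element of
  the image class in \<open>H\<close>, so the two top elements have equal order; since a class is a
  top segment, this order and the class size fix all counts.\<close>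

lemma card_ord_twins_f:
  assumes good: "G.good" and x: "x \<in> carrier G"
  shows "card {w \<in> H.twins (f x). H.ord w = d} = card {w \<in> G.twins x. G.ord w = d}"
proof -
  obtain y where y: "y \<in> G.twins x" "\<And>z. z \<in> G.twins x \<Longrightarrow> z \<in> generate G {y}"
    using G.ex_top_twin[OF x] by blast
  obtain y' where y': "y' \<in> H.twins (f x)" "\<And>z. z \<in> H.twins (f x) \<Longrightarrow> z \<in> generate H {y'}"
    using H.ex_top_twin[OF f_closed[OF x]] by blast
  have yc: "y \<in> carrier G" "G.twin y x" using y by (auto simp: G.twins_def)
  have yc': "y' \<in> carrier H" "H.twin y' (f x)" using y' by (auto simp: H.twins_def)
  have tw: "G.twins y = G.twins x" "H.twins y' = H.twins (f x)"
    using G.twins_eq_iff H.twins_eq_iff yc yc' x f_closed by blast+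
  have goodH: "H.good" using good good_f by simp
  \<comment> \<open>The description refers to \<open>x\<close> and not to \<open>y\<close> because
    \<open>f y\<close> need not be \<open>y'\<close>, whereas \<open>f x\<close> is a twin of
    \<open>y'\<close>.\<close>
  have down: "generate G {y} = {z \<in> carrier G. G.twin z x \<or> G.strictly_below z x}"
  proof -
    have "G.twin z y \<longleftrightarrow> G.twin z x" for z using yc(2) G.twin_trans G.twin_sym by blast
    moreover have "G.strictly_below z y \<longleftrightarrow> G.strictly_below z x" if "z \<in> carrier G" for z
      by (rule G.strictly_below_cong[OF good that that yc(1) x G.twin_refl yc(2)])
    moreover have "generate G {y} = {z \<in> carrier G. G.twin z y \<or> G.strictly_below z y}"
      using y(2) tw by (intro G.generate_top_eq[OF good yc(1)]) simp
    ultimately show ?thesis by (simp cong: conj_cong)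
  qed
  have down': "generate H {y'} = {z \<in> carrier H. H.twin z (f x) \<or> H.strictly_below z (f x)}"
  proof -
    have "H.twin z y' \<longleftrightarrow> H.twin z (f x)" for z using yc'(2) H.twin_trans H.twin_sym by blast
    moreover have "H.strictly_below z y' \<longleftrightarrow> H.strictly_below z (f x)" if "z \<in> carrier H" for z
      by (rule H.strictly_below_cong[OF goodH that that yc'(1) f_closed[OF x] H.twin_refl yc'(2)])
    moreover have "generate H {y'} = {z \<in> carrier H. H.twin z y' \<or> H.strictly_below z y'}"
      using y'(2) tw by (intro H.generate_top_eq[OF goodH yc'(1)]) simp
    ultimately show ?thesis by (simp cong: conj_cong)
  qed
  have "generate H {y'} = f ` generate G {y}"
    unfolding down down' by (rule Collect_carrier_H) (simp add: twin_f x strictly_below_f[OF good])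
  then have ord: "H.ord y' = G.ord y"
    using card_image_f[of "generate G {y}"] G.card_generate[OF yc(1)] H.card_generate[OF yc'(1)]
      G.generate_closed[OF yc(1)] by auto
  have cd: "card (H.twins (f x)) = card (G.twins x)" using card_twins_f[OF x] .
  have seg: "G.twins x = {z \<in> generate G {y}. G.ord y < G.ord z + card (G.twins x)}"
    using G.twins_eq_top_segment[OF good yc(1)] y(2) tw by simp
  have seg': "H.twins (f x) = {z \<in> generate H {y'}. H.ord y' < H.ord z + card (H.twins (f x))}"
    using H.twins_eq_top_segment[OF goodH yc'(1)] y'(2) tw by simp
  have "{w \<in> G.twins x. G.ord w = d} =
      (if G.ord y < d + card (G.twins x) then {z \<in> generate G {y}. G.ord z = d} else {})"
    using seg by auto
  moreover have "{w \<in> H.twins (f x). H.ord w = d} =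
      (if G.ord y < d + card (G.twins x) then {z \<in> generate H {y'}. H.ord z = d} else {})"
    using seg' unfolding ord cd by auto
  ultimately show ?thesis
    using G.card_ord_in_generate[OF yc(1)] H.card_ord_in_generate[OF yc'(1)] ord by simp
qed

text \<open>Elements are coloured by twin class and order, and the fibres of the two colourings have
  equal size. A colour-preserving bijection respects generation: between twins it is decided by
  orders, between different classes by \<open>strictly_below\<close>, which depends only on the
  classes.\<close>

lemma ex_directed_power_iso_good:
  assumes good: "G.good"
  shows "\<exists>g. directed_power_iso G H g"
proof -
  have goodH: "H.good" using good good_f by simp
  \<comment> \<open>Classes of \<open>G\<close> are named by their images in \<open>H\<close>, so
    that both colourings take values in the same type.\<close>
  define c where "c x = (f ` G.twins x, G.ord x)" for x
  define c' where "c' x = (H.twins x, H.ord x)" for x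
  have "card {a \<in> carrier G. c a = k} = card {b \<in> carrier H. c' b = k}" for k
  proof -
    obtain U d where k: "k = (U, d)" by (cases k)
    show ?thesis
    proof (cases "\<exists>x\<in>carrier G. U = f ` G.twins x")
      case True
      then obtain x where x: "x \<in> carrier G" "U = f ` G.twins x" by blast
      have "f ` G.twins a = f ` G.twins x \<longleftrightarrow> a \<in> G.twins x" if "a \<in> carrier G" for a
        unfolding twins_f[OF that, symmetric] twins_f[OF x(1), symmetric]
        using that x by (simp add: H.twins_eq_iff f_closed twin_f G.twins_def)
      moreover have "G.twins x \<subseteq> carrier G" by (auto simp: G.twins_def)
      ultimately have eqG: "{a \<in> carrier G. c a = k} = {a \<in> G.twins x. G.ord a = d}"
        unfolding k c_def x(2) prod.inject by blast
      have "H.twins b = H.twins (f x) \<longleftrightarrow> b \<in> H.twins (f x)" if "b \<in> carrier H" for b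
        using that x H.twins_eq_iff f_closed by (simp add: H.twins_def)
      moreover have "H.twins (f x) \<subseteq> carrier H" by (auto simp: H.twins_def)
      ultimately have "{b \<in> carrier H. c' b = k} = {b \<in> H.twins (f x). H.ord b = d}"
        unfolding k c'_def x(2) twins_f[OF x(1), symmetric] prod.inject by blast
      then show ?thesis using eqG card_ord_twins_f[OF good x(1)] by simp
    next
      case False
      then have "{a \<in> carrier G. c a = k} = {}" "{b \<in> carrier H. c' b = k} = {}"
        unfolding k c_def c'_def using f_surj twins_f by fastforce+
      then show ?thesis by (simp only: card.empty)
    qed
  qed
  then obtain g where g: "bij_betw g (carrier G) (carrier H)" and gc: "\<And>a. a \<in> carrier G \<Longrightarrow> c' (g a) = c a"
    using bij_betw_of_card_fibres[of "carrier G" "carrier H" c c'] by auto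
  have gcl: "g a \<in> carrier H" if "a \<in> carrier G" for a using g that bij_betwE by blast
  have gord: "H.ord (g a) = G.ord a" if "a \<in> carrier G" for a
    using gc[OF that] by (simp add: c_def c'_def)
  have gtw: "H.twin (g a) (f a)" if a: "a \<in> carrier G" for a
  proof -
    have "H.twins (g a) = H.twins (f a)" using gc[OF a] twins_f[OF a] by (simp add: c_def c'_def)
    then show ?thesis using H.twins_eq_iff gcl f_closed a by blast
  qed
  have "x \<in> generate G {y} \<longleftrightarrow> g x \<in> generate H {g y}" if xy: "x \<in> carrier G" "y \<in> carrier G" for x y
  proof -
    have tw: "H.twin (g x) (g y) \<longleftrightarrow> G.twin x y"
      using gtw xy twin_f[OF xy] H.twin_sym H.twin_trans by metis
    show ?thesis
    proof (cases "G.twin x y")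
      case True
      then have "G.comparable x y" "H.comparable (g x) (g y)"
        using tw G.twin_imp_comparable H.twin_imp_comparable xy gcl by blast+
      then show ?thesis using G.comparable_imp_below_iff H.comparable_imp_below_iff xy gcl gord by simp
    next
      case False
      have "x \<in> generate G {y} \<longleftrightarrow> G.strictly_below x y" using False by (simp add: G.strictly_below_def)
      also have "\<dots> \<longleftrightarrow> H.strictly_below (f x) (f y)" using strictly_below_f[OF good xy] by simp
      also have "\<dots> \<longleftrightarrow> H.strictly_below (g x) (g y)"
        by (rule H.strictly_below_cong[OF goodH f_closed[OF xy(1)] gcl[OF xy(1)] f_closed[OF xy(2)]
              gcl[OF xy(2)] H.twin_sym[OF gtw[OF xy(1)]] H.twin_sym[OF gtw[OF xy(2)]]])
      also have "\<dots> \<longleftrightarrow> g x \<in> generate H {g y}" using False tw by (simp add: H.strictly_below_def)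
      finally show ?thesis .
    qed
  qed
  then show ?thesis unfolding directed_power_iso_def using g by blast
qed

text \<open>Both groups are cyclic of the same order. Generation inside a cyclic group is
  divisibility of orders, so any order-preserving bijection works, and \<open>f\<close> itself is
  discarded.\<close>

lemma ex_directed_power_iso_not_good:
  assumes "\<not> G.good"
  shows "\<exists>g. directed_power_iso G H g"
proof -
  obtain x where x: "x \<in> carrier G" "carrier G = generate G {x}"
    using G.not_good_imp_cyclic[OF assms] by blast
  obtain y where y: "y \<in> carrier H" "carrier H = generate H {y}"
    using H.not_good_imp_cyclic assms good_f by blast
  have "H.ord y = G.ord x"
    using G.card_generate[OF x(1)] H.card_generate[OF y(1)] order_eq x(2) y(2) by (simp add: order_def)
  then have "card {a \<in> carrier G. G.ord a = k} = card {b \<in> carrier H. H.ord b = k}" for k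
    using G.card_ord_in_generate[OF x(1)] H.card_ord_in_generate[OF y(1)] x(2) y(2) by simp
  then obtain g where g: "bij_betw g (carrier G) (carrier H)"
      and gord: "\<And>a. a \<in> carrier G \<Longrightarrow> H.ord (g a) = G.ord a"
    using bij_betw_of_card_fibres[of "carrier G" "carrier H" G.ord H.ord] by auto
  have "a \<in> generate G {b} \<longleftrightarrow> g a \<in> generate H {g b}" if ab: "a \<in> carrier G" "b \<in> carrier G" for a b
  proof -
    have "g a \<in> carrier H" "g b \<in> carrier H" using g ab bij_betwE by blast+
    then show ?thesis
      using G.mem_generate_iff_ord_dvd[OF x(1)] H.mem_generate_iff_ord_dvd[OF y(1)] x(2) y(2) ab gord
      by simp
  qed
  then show ?thesis unfolding directed_power_iso_def using g by blast
qed

end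

theorem power_graph_iso_imp_directed:
  assumes "group G" "finite (carrier G)" "group H" "finite (carrier H)" "power_graph_iso G H"
  shows "\<exists>g. directed_power_iso G H g"
proof -
  obtain f where "bij_betw f (carrier G) (carrier H)"
      "\<forall>x\<in>carrier G. \<forall>y\<in>carrier G. power_adj G x y \<longleftrightarrow> power_adj H (f x) (f y)"
    using assms(5) unfolding power_graph_iso_def by blast
  then interpret power_graph_isomorphism G H f
    using assms by (intro power_graph_isomorphism.intro finite_group.intro finite_group_axioms.intro
        power_graph_isomorphism_axioms.intro) auto
  show ?thesis using ex_directed_power_iso_good ex_directed_power_iso_not_good by blast
qed

lemma directed_power_iso_imp_power_graph_iso:
  assumes "directed_power_iso G H g"
  shows "power_graph_iso G H"
  unfolding power_graph_iso_def
proof (intro exI conjI ballI)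
  show b: "bij_betw g (carrier G) (carrier H)" using assms by (simp add: directed_power_iso_def)
  fix x y assume "x \<in> carrier G" "y \<in> carrier G"
  then show "power_adj G x y = power_adj H (g x) (g y)"
    using assms b unfolding power_adj_def directed_power_iso_def bij_betw_def inj_on_def by blast
qed

text \<open>The order is the number of elements generated, and \<open>g\<close> maps the subgroup
  generated by \<open>x\<close> onto the one generated by \<open>g x\<close>.\<close>

lemma directed_power_iso_ord:
  assumes "finite_group G" "finite_group H" "directed_power_iso G H g" "x \<in> carrier G"
  shows "group.ord H (g x) = group.ord G x"
proof -
  interpret G: finite_group G by fact
  interpret H: finite_group H by fact
  have bij: "bij_betw g (carrier G) (carrier H)" using assms by (simp add: directed_power_iso_def)
  have gx: "g x \<in> carrier H" using bij assms(4) bij_betwE by blast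
  have sub: "generate G {x} \<subseteq> carrier G" using G.generate_closed assms(4) by blast
  have "generate H {g x} = g ` generate G {x}"
  proof (intro equalityI subsetI)
    fix z assume z: "z \<in> generate H {g x}"
    then have "z \<in> carrier H" using H.generate_closed gx by blast
    then obtain w where w: "w \<in> carrier G" "z = g w" using bij unfolding bij_betw_def by blast
    then show "z \<in> g ` generate G {x}" using z assms(3,4) unfolding directed_power_iso_def by blast
  next
    fix z assume "z \<in> g ` generate G {x}"
    then show "z \<in> generate H {g x}" using sub assms(3,4) unfolding directed_power_iso_def by blast
  qed
  then have "card (generate H {g x}) = card (generate G {x})"
    using bij sub by (metis bij_betw_imp_inj_on card_image inj_on_subset)
  then show ?thesis using G.card_generate[OF assms(4)] H.card_generate[OF gx] by simp
qed

section \<open>Commutators and the lower central series\<close>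

lemma (in group) conj_nat_pow:
  assumes "g \<in> carrier G" "x \<in> carrier G"
  shows "(g \<otimes> x \<otimes> inv g) [^] (k::nat) = g \<otimes> x [^] k \<otimes> inv g"
proof (induction k)
  case (Suc k)
  have "inv g \<otimes> (g \<otimes> z) = z" if "z \<in> carrier G" for z
    using that assms by (simp add: m_assoc[symmetric])
  then show ?case using Suc assms by (simp add: m_assoc)
qed (use assms in simp)

lemma (in group) ord_conj:
  assumes g: "g \<in> carrier G" and x: "x \<in> carrier G"
  shows "ord (g \<otimes> x \<otimes> inv g) = ord x"
proof -
  have "g \<otimes> y \<otimes> inv g = \<one> \<longleftrightarrow> y = \<one>" if "y \<in> carrier G" for y
    using that g by (metis conjugation_is_inj one_closed r_inv r_one)
  then show ?thesis
    using g x by (simp add: ord_unique conj_nat_pow pow_eq_id[symmetric])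
qed

lemma (in group) commutator_eq_one_iff:
  assumes "x \<in> carrier G" "y \<in> carrier G"
  shows "x \<otimes> y \<otimes> inv x \<otimes> inv y = \<one> \<longleftrightarrow> x \<otimes> y = y \<otimes> x"
proof -
  have "x \<otimes> y \<otimes> inv x \<otimes> inv y = (x \<otimes> y) \<otimes> inv (y \<otimes> x)"
    using assms by (simp add: m_assoc inv_mult_group)
  then show ?thesis using assms by (metis inv_equality inv_inv m_closed inv_closed r_inv)
qed

lemma (in group) inv_commute:
  assumes "x \<in> carrier G" "y \<in> carrier G" "x \<otimes> y = y \<otimes> x"
  shows "inv x \<otimes> y = y \<otimes> inv x"
proof -
  have "inv x \<otimes> y = inv x \<otimes> (y \<otimes> x) \<otimes> inv x" using assms(1,2) by (simp add: m_assoc)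
  also have "\<dots> = inv x \<otimes> (x \<otimes> y) \<otimes> inv x" using assms(3) by simp
  also have "\<dots> = y \<otimes> inv x" using assms(1,2) by (simp flip: m_assoc)
  finally show ?thesis .
qed

text \<open>Here \<open>c\<close> is the commutator of \<open>x\<close> and \<open>y\<close>; moving
  \<open>y\<close> past each factor \<open>x\<close> releases one copy of it, and the copies can be
  collected because they commute with \<open>x\<close>.\<close>

lemma (in group) central_commutator_pow:
  assumes c: "c \<in> carrier G" and x: "x \<in> carrier G" and y: "y \<in> carrier G"
    and xy: "x \<otimes> y = c \<otimes> (y \<otimes> x)" and cx: "c \<otimes> x = x \<otimes> c"
  shows "x [^] (k::nat) \<otimes> y = c [^] k \<otimes> (y \<otimes> x [^] k)"
proof (induction k)
  case (Suc k)
  have cxk: "x \<otimes> c [^] k = c [^] k \<otimes> x"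
    using cx c x by (induction k) (auto simp: m_assoc, metis m_assoc nat_pow_closed)
  have "x [^] Suc k \<otimes> y = x \<otimes> (x [^] k \<otimes> y)" using x y by (simp only: nat_pow_Suc2 m_assoc nat_pow_closed)
  also have "\<dots> = (x \<otimes> c [^] k) \<otimes> (y \<otimes> x [^] k)" using Suc c x y by (simp add: m_assoc)
  also have "\<dots> = c [^] k \<otimes> ((x \<otimes> y) \<otimes> x [^] k)" unfolding cxk using c x y by (simp add: m_assoc)
  also have "\<dots> = c [^] k \<otimes> c \<otimes> (y \<otimes> (x \<otimes> x [^] k))" unfolding xy using c x y by (simp add: m_assoc)
  also have "\<dots> = c [^] Suc k \<otimes> (y \<otimes> x [^] Suc k)"
    using nat_pow_Suc[of c k] nat_pow_Suc2[OF x, of k] by (simp only:)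
  finally show ?case .
qed (use assms in simp)

lemma (in group) central_commutator_ord:
  assumes c: "c \<in> carrier G" and x: "x \<in> carrier G" and y: "y \<in> carrier G"
    and xy: "x \<otimes> y = c \<otimes> (y \<otimes> x)" and cx: "c \<otimes> x = x \<otimes> c"
  shows "ord c dvd ord x"
proof -
  have "y = c [^] ord x \<otimes> y" using central_commutator_pow[OF assms, of "ord x"] x y by simp
  then have "c [^] ord x = \<one>" using c y by (metis l_one nat_pow_closed one_closed right_cancel)
  then show ?thesis using c pow_eq_id by blast
qed

lemma (in normal) r_coset_eq_one_iff:
  assumes "x \<in> carrier G"
  shows "H #> x = \<one>\<^bsub>G Mod H\<^esub> \<longleftrightarrow> x \<in> H"
proof -
  have "\<one>\<^bsub>G Mod H\<^esub> = H" by (simp add: FactGroup_def)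
  then show ?thesis using coset_join2[OF assms is_subgroup] rcos_self[OF assms is_subgroup] by auto
qed

lemma (in normal) group_hom_Mod: "group_hom G (G Mod H) (\<lambda>x. H #> x)"
  by (intro group_hom.intro group_hom_axioms.intro factorgroup_is_group r_coset_hom_Mod is_group)

lemma (in normal) commutator_mem_iff:
  assumes x: "x \<in> carrier G" and g: "g \<in> carrier G"
  shows "x \<otimes> g \<otimes> inv x \<otimes> inv g \<in> H \<longleftrightarrow>
    (H #> x) \<otimes>\<^bsub>G Mod H\<^esub> (H #> g) = (H #> g) \<otimes>\<^bsub>G Mod H\<^esub> (H #> x)"
proof -
  interpret q: group_hom G "G Mod H" "\<lambda>x. H #> x" by (rule group_hom_Mod)
  have "x \<otimes> g \<otimes> inv x \<otimes> inv g \<in> H \<longleftrightarrow> H #> (x \<otimes> g \<otimes> inv x \<otimes> inv g) = \<one>\<^bsub>G Mod H\<^esub>"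
    using x g by (intro r_coset_eq_one_iff[symmetric]) auto
  also have "H #> (x \<otimes> g \<otimes> inv x \<otimes> inv g) =
      (H #> x) \<otimes>\<^bsub>G Mod H\<^esub> (H #> g) \<otimes>\<^bsub>G Mod H\<^esub> inv\<^bsub>G Mod H\<^esub> (H #> x) \<otimes>\<^bsub>G Mod H\<^esub> inv\<^bsub>G Mod H\<^esub> (H #> g)"
    using x g by (simp only: q.hom_mult q.hom_inv m_closed inv_closed)
  finally show ?thesis using q.H.commutator_eq_one_iff[OF q.hom_closed[OF x] q.hom_closed[OF g]] by simp
qed

lemma (in group) lower_central_step_mono:
  "K \<subseteq> L \<Longrightarrow> lower_central_step G K \<subseteq> lower_central_step G L"
  unfolding lower_central_step_def by (intro mono_generate) blast

lemma (in group) commutator_mem_lower_central_step: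
  "x \<in> K \<Longrightarrow> g \<in> carrier G \<Longrightarrow> x \<otimes> g \<otimes> inv x \<otimes> inv g \<in> lower_central_step G K"
  unfolding lower_central_step_def by (rule generate.incl) blast

lemma (in group) lower_central_step_normal:
  assumes "K \<lhd> G"
  shows "lower_central_step G K \<lhd> G"
  unfolding lower_central_step_def
proof (rule normal_generateI)
  have sub: "K \<subseteq> carrier G" using assms by (simp add: normal_imp_subgroup subgroup.subset)
  show "(\<Union>h\<in>K. \<Union>g\<in>carrier G. {h \<otimes> g \<otimes> inv h \<otimes> inv g}) \<subseteq> carrier G"
    using sub by auto
  fix c t assume "c \<in> (\<Union>h\<in>K. \<Union>g\<in>carrier G. {h \<otimes> g \<otimes> inv h \<otimes> inv g})" and t: "t \<in> carrier G"
  then obtain h g where h: "h \<in> K" and g: "g \<in> carrier G" and c: "c = h \<otimes> g \<otimes> inv h \<otimes> inv g" by blast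
  have hc: "h \<in> carrier G" using sub h by blast
  have "t \<otimes> h \<otimes> inv t \<in> K" using assms h t normal_inv_iff by blast
  moreover have "t \<otimes> c \<otimes> inv t = (t \<otimes> h \<otimes> inv t) \<otimes> (t \<otimes> g \<otimes> inv t) \<otimes> inv (t \<otimes> h \<otimes> inv t) \<otimes> inv (t \<otimes> g \<otimes> inv t)"
  proof -
    have cancel: "inv t \<otimes> (t \<otimes> z) = z" if "z \<in> carrier G" for z
      using that t by (simp add: m_assoc[symmetric])
    show ?thesis unfolding c using hc g t by (simp add: m_assoc inv_mult_group cancel)
  qed
  ultimately show "t \<otimes> c \<otimes> inv t \<in> (\<Union>h\<in>K. \<Union>g\<in>carrier G. {h \<otimes> g \<otimes> inv h \<otimes> inv g})"
    using g t by blast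
qed

lemma (in group) lower_central_series_normal: "(lower_central_step G ^^ n) (carrier G) \<lhd> G"
  by (induction n) (simp_all add: normal_self lower_central_step_normal)

text \<open>The commutator of \<open>x\<close> and \<open>y\<close> lies in every term of the lower
  central series. Once it lies in one term, it is central modulo the next; there its order divides
  the orders of the images of both \<open>x\<close> and \<open>y\<close>, which are coprime, so it
  vanishes modulo that next term.\<close>

lemma (in group) nilpotent_coprime_ord_commute:
  assumes nil: "nilpotent_group G" and x: "x \<in> carrier G" and y: "y \<in> carrier G"
    and cop: "coprime (ord x) (ord y)"
  shows "x \<otimes> y = y \<otimes> x"
proof -
  let ?c = "x \<otimes> y \<otimes> inv x \<otimes> inv y"
  have cc: "?c \<in> carrier G" using x y by simp
  have "?c \<in> (lower_central_step G ^^ n) (carrier G)" for n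
  proof (induction n)
    case 0
    show ?case using cc by simp
  next
    case (Suc n)
    define L where "L = (lower_central_step G ^^ Suc n) (carrier G)"
    interpret L: normal L G unfolding L_def by (rule lower_central_series_normal)
    interpret q: group_hom G "G Mod L" "\<lambda>x. L #> x" by (rule L.group_hom_Mod)
    let ?Q = "G Mod L"
    have central: "(L #> ?c) \<otimes>\<^bsub>?Q\<^esub> (L #> g) = (L #> g) \<otimes>\<^bsub>?Q\<^esub> (L #> ?c)" if g: "g \<in> carrier G" for g
      using commutator_mem_lower_central_step[OF Suc g] L.commutator_mem_iff[OF cc g]
      by (simp add: L_def)
    have "x \<otimes> y = ?c \<otimes> (y \<otimes> x)"
    proof -
      have "?c = (x \<otimes> y) \<otimes> inv (y \<otimes> x)" using x y by (simp add: m_assoc inv_mult_group)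
      then show ?thesis using x y by (simp add: m_assoc)
    qed
    then have e1: "(L #> x) \<otimes>\<^bsub>?Q\<^esub> (L #> y) = (L #> ?c) \<otimes>\<^bsub>?Q\<^esub> ((L #> y) \<otimes>\<^bsub>?Q\<^esub> (L #> x))"
      using x y cc by (metis m_closed q.hom_mult)
    have QC: "L #> ?c \<in> carrier ?Q" "L #> x \<in> carrier ?Q" "L #> y \<in> carrier ?Q"
      using q.hom_closed x y cc by blast+
    have ord_le: "q.H.ord (L #> z) dvd ord z" if z: "z \<in> carrier G" for z
    proof -
      have "(L #> z) [^]\<^bsub>?Q\<^esub> ord z = L #> (z [^] ord z)" using z by (simp only: q.hom_nat_pow)
      also have "\<dots> = \<one>\<^bsub>?Q\<^esub>" using z by (simp only: pow_ord_eq_1 q.hom_one)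
      finally show ?thesis using q.H.pow_eq_id[OF q.hom_closed[OF z]] by blast
    qed
    have d1: "q.H.ord (L #> ?c) dvd q.H.ord (L #> x)"
      by (rule q.H.central_commutator_ord[OF QC e1 central[OF x]])
    have invC: "inv\<^bsub>?Q\<^esub> (L #> ?c) \<in> carrier ?Q" using QC by simp
    \<comment> \<open>With the roles of \<open>x\<close> and \<open>y\<close> exchanged, the
      commutator becomes its inverse, which has the same order.\<close>
    have e2: "(L #> y) \<otimes>\<^bsub>?Q\<^esub> (L #> x) = inv\<^bsub>?Q\<^esub> (L #> ?c) \<otimes>\<^bsub>?Q\<^esub> ((L #> x) \<otimes>\<^bsub>?Q\<^esub> (L #> y))"
      unfolding e1 using QC invC by (simp only: q.H.m_closed q.H.l_inv q.H.l_one flip: q.H.m_assoc)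
    have comm: "inv\<^bsub>?Q\<^esub> (L #> ?c) \<otimes>\<^bsub>?Q\<^esub> (L #> y) = (L #> y) \<otimes>\<^bsub>?Q\<^esub> inv\<^bsub>?Q\<^esub> (L #> ?c)"
      using central[OF y] QC by (intro q.H.inv_commute)
    have d2: "q.H.ord (L #> ?c) dvd q.H.ord (L #> y)"
      using q.H.central_commutator_ord[OF invC QC(3,2) e2 comm] QC by simp
    have "q.H.ord (L #> ?c) = 1"
      using d1 d2 ord_le[OF x] ord_le[OF y] cop by (meson coprime_common_divisor_nat dvd_trans)
    then have "L #> ?c = \<one>\<^bsub>?Q\<^esub>" using q.H.ord_eq_1[OF QC(1)] by blast
    then have "?c \<in> L" using L.r_coset_eq_one_iff[OF cc] by blast
    then show ?case by (simp add: L_def)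
  qed
  then have "?c = \<one>" using nil unfolding nilpotent_group_def by blast
  then show ?thesis using commutator_eq_one_iff x y by blast
qed

section \<open>Nilpotent groups and elements of prime power order\<close>

context finite_group
begin

definition p_elements :: "nat \<Rightarrow> 'a set" where
  "p_elements p = {x \<in> carrier G. \<exists>k. ord x = p ^ k}"

text \<open>The elementwise form of nilpotency that mediates between the lower central series and
  the counts of \<open>p\<close>-elements.\<close>

definition primary_commuting :: bool where
  "primary_commuting \<longleftrightarrow> (\<forall>p q x y. prime p \<longrightarrow> prime q \<longrightarrow> p \<noteq> q \<longrightarrow>
     x \<in> p_elements p \<longrightarrow> y \<in> p_elements q \<longrightarrow> x \<otimes> y = y \<otimes> x)"

lemma order_pos: "order G > 0"
  by (simp add: order_gt_0_iff_finite)

lemma subgroup_finite: "subgroup K G \<Longrightarrow> finite K"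
  by (rule finite_subset[OF subgroup.subset fin])

lemma ex_sylow_subgroup:
  assumes "prime p"
  obtains P where "sylow_subgroup G p P"
proof -
  have "order G = p ^ multiplicity p (order G) * (order G div p ^ multiplicity p (order G))"
    by (simp add: multiplicity_dvd)
  from sylow_thm[OF assms is_group this fin] show ?thesis
    using that unfolding sylow_subgroup_def by blast
qed

lemma sylow_subset_p_elements:
  assumes "prime p" "sylow_subgroup G p P"
  shows "P \<subseteq> p_elements p"
proof
  fix x assume x: "x \<in> P"
  have P: "subgroup P G" "card P = p ^ multiplicity p (order G)"
    using assms by (auto simp: sylow_subgroup_def)
  have "ord x dvd p ^ multiplicity p (order G)" using ord_dvd_card_subgroup[OF P(1) x] P(2) by simp
  then have "\<exists>k. ord x = p ^ k" using assms(1) divides_primepow_nat by blast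
  then show "x \<in> p_elements p" unfolding p_elements_def using subgroup.mem_carrier[OF P(1) x] by blast
qed

lemma subgroup_dvd:
  assumes N: "subgroup N G" and P: "subgroup P G" and sub: "P \<subseteq> N"
  shows "card P dvd card N"
proof -
  have "card P dvd order (G\<lparr>carrier := N\<rparr>)"
    using group.lagrange[OF subgroup_imp_group[OF N] subgroup_incl[OF P N sub]] by (metis dvd_triv_right)
  then show ?thesis by (simp add: order_def)
qed

text \<open>The order of \<open>G\<close> divides that of \<open>N\<close>, prime by prime. This
  reduces a normality or centrality claim to one Sylow subgroup for each prime.\<close>

lemma subgroup_eq_carrier_if_sylow:
  assumes N: "subgroup N G"
    and syl: "\<And>q. prime q \<Longrightarrow> \<exists>Q. sylow_subgroup G q Q \<and> Q \<subseteq> N"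
  shows "N = carrier G"
proof -
  have fN: "finite N" by (rule subgroup_finite[OF N])
  have cN: "card N > 0" using fN subgroup.one_closed[OF N] by (auto simp: card_gt_0_iff)
  have "order G dvd card N"
  proof (rule multiplicity_le_imp_dvd)
    show "order G \<noteq> 0" using order_pos by simp
    fix q :: nat assume q: "prime q"
    obtain Q where Q: "sylow_subgroup G q Q" "Q \<subseteq> N" using syl[OF q] by blast
    have "q ^ multiplicity q (order G) dvd card N"
      using subgroup_dvd[OF N _ Q(2)] Q(1) unfolding sylow_subgroup_def by auto
    then show "multiplicity q (order G) \<le> multiplicity q (card N)"
      using q cN by (intro multiplicity_geI) auto
  qed
  then have "card (carrier G) \<le> card N" using cN by (auto simp: order_def dest: dvd_imp_le)
  then show ?thesis using card_seteq[OF fin subgroup.subset[OF N]] by blast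
qed

lemma finite_subgroupI:
  assumes "N \<subseteq> carrier G" "\<one> \<in> N" "\<And>x y. x \<in> N \<Longrightarrow> y \<in> N \<Longrightarrow> x \<otimes> y \<in> N"
  shows "subgroup N G"
proof (rule subgroupI)
  fix x assume x: "x \<in> N"
  then have xc: "x \<in> carrier G" using assms(1) by blast
  have pow: "x [^] (k::nat) \<in> N" for k using x assms by (induction k) auto
  have "x \<otimes> x [^] (ord x - 1) = x [^] Suc (ord x - 1)" using xc by (simp only: nat_pow_Suc2)
  then have "x \<otimes> x [^] (ord x - 1) = \<one>" using ord_pos[OF xc] xc by simp
  then have "inv x = x [^] (ord x - 1)" using xc by (metis inv_char nat_pow_closed inv_comm)
  then show "inv x \<in> N" using pow by simp
qed (use assms in auto)

lemma commuting_elements_subgroup: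
  assumes "x \<in> carrier G"
  shows "subgroup {g \<in> carrier G. x \<otimes> g = g \<otimes> x} G"
proof (rule finite_subgroupI)
  fix g h assume "g \<in> {g \<in> carrier G. x \<otimes> g = g \<otimes> x}" "h \<in> {g \<in> carrier G. x \<otimes> g = g \<otimes> x}"
  then have gh: "g \<in> carrier G" "h \<in> carrier G" "x \<otimes> g = g \<otimes> x" "x \<otimes> h = h \<otimes> x" by auto
  have "x \<otimes> (g \<otimes> h) = (x \<otimes> g) \<otimes> h" using gh(1,2) assms by (simp add: m_assoc)
  also have "\<dots> = g \<otimes> (x \<otimes> h)" unfolding gh(3) using gh(1,2) assms by (simp add: m_assoc)
  also have "\<dots> = (g \<otimes> h) \<otimes> x" unfolding gh(4) using gh(1,2) assms by (simp add: m_assoc)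
  finally show "g \<otimes> h \<in> {g \<in> carrier G. x \<otimes> g = g \<otimes> x}" using gh by simp
qed (use assms in auto)

text \<open>The normalizer of \<open>P\<close> contains \<open>P\<close> and, for every other prime,
  a Sylow subgroup that even centralizes \<open>P\<close>; so \<open>P\<close> is normal. The index
  \<open>B\<close> of \<open>P\<close> is prime to \<open>p\<close>, hence a
  \<open>p\<close>-element \<open>x\<close> is generated by its power with exponent
  \<open>B\<close>, and that power is trivial modulo \<open>P\<close>.\<close>

lemma sylow_eq_p_elements:
  assumes C: primary_commuting and p: "prime p" and P: "sylow_subgroup G p P"
  shows "P = p_elements p"
proof
  show "P \<subseteq> p_elements p" by (rule sylow_subset_p_elements[OF p P])
  have sP: "subgroup P G" and cP: "card P = p ^ multiplicity p (order G)"
    using P by (auto simp: sylow_subgroup_def)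
  have PG: "P \<subseteq> carrier G" by (rule subgroup.subset[OF sP])
  define N where "N = {g \<in> carrier G. \<forall>x\<in>P. g \<otimes> x \<otimes> inv g \<in> P}"
  have sN: "subgroup N G"
  proof (rule finite_subgroupI)
    show "\<one> \<in> N" using PG by (auto simp: N_def)
    fix g h assume "g \<in> N" "h \<in> N"
    moreover from this have "g \<otimes> h \<otimes> x \<otimes> inv (g \<otimes> h) = g \<otimes> (h \<otimes> x \<otimes> inv h) \<otimes> inv g" if "x \<in> P" for x
      using that PG by (auto simp: N_def m_assoc inv_mult_group)
    ultimately show "g \<otimes> h \<in> N" by (auto simp: N_def)
  qed (auto simp: N_def)
  have "N = carrier G"
  proof (rule subgroup_eq_carrier_if_sylow[OF sN])
    fix q :: nat assume q: "prime q"
    show "\<exists>Q. sylow_subgroup G q Q \<and> Q \<subseteq> N"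
    proof (cases "q = p")
      case True
      have "P \<subseteq> N" using PG subgroup.m_closed[OF sP] subgroup.m_inv_closed[OF sP]
        by (auto simp: N_def)
      then show ?thesis using True P by blast
    next
      case False
      obtain Q where Q: "sylow_subgroup G q Q" using ex_sylow_subgroup[OF q] by blast
      have "Q \<subseteq> N"
      proof
        fix g assume g: "g \<in> Q"
        have gc: "g \<in> carrier G" using Q g subgroup.mem_carrier unfolding sylow_subgroup_def by metis
        have "g \<otimes> x \<otimes> inv g = x" if x: "x \<in> P" for x
        proof -
          have "x \<otimes> g = g \<otimes> x"
            using C p q False x g sylow_subset_p_elements[OF p P] sylow_subset_p_elements[OF q Q]
            unfolding primary_commuting_def by blast
          then show ?thesis using gc x PG by (metis inv_solve_right subsetD m_closed)
        qed
        then show "g \<in> N" using gc by (simp add: N_def)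
      qed
      then show ?thesis using Q by blast
    qed
  qed
  then have nP: "P \<lhd> G" using sP by (auto simp: normal_inv_iff N_def)
  interpret P: normal P G by (rule nP)
  show "p_elements p \<subseteq> P"
  proof
    fix x assume "x \<in> p_elements p"
    then obtain k where xc: "x \<in> carrier G" and k: "ord x = p ^ k" by (auto simp: p_elements_def)
    let ?Q = "G Mod P"
    interpret q: group_hom G ?Q "\<lambda>x. P #> x" by (rule P.group_hom_Mod)
    define B where "B = order ?Q"
    have "B * card P = order G" unfolding B_def using lagrange[OF sP] by (simp add: order_def FactGroup_def)
    then have ord_B: "B * p ^ multiplicity p (order G) = order G" using cP by simp
    have "\<not> p dvd B"
    proof
      assume "p dvd B"
      then have "p ^ Suc (multiplicity p (order G)) dvd order G"
        using ord_B by (metis mult_dvd_mono dvd_refl power_Suc)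
      then show False using p order_pos by (metis multiplicity_geI not_prime_unit Suc_n_not_le_n nat_neq_iff)
    qed
    then have "coprime B (ord x)" using p k by (metis coprime_commute coprime_power_left_iff prime_imp_coprime)
    then have "ord (x [^] B) = ord x" using pow_ord_eq_ord_iff[OF fin xc] by blast
    moreover have "x [^] B \<in> generate G {x}" using mem_generate_iff[OF xc] by blast
    ultimately have xin: "x \<in> generate G {x [^] B}"
      using mem_generate_iff_ord_dvd[OF xc generate_refl, of "x [^] B"] by simp
    have "P #> (x [^] B) = (P #> x) [^]\<^bsub>?Q\<^esub> B" using xc by (simp only: q.hom_nat_pow)
    also have "\<dots> = \<one>\<^bsub>?Q\<^esub>" unfolding B_def using xc by (intro q.H.pow_order_eq_1 q.hom_closed)
    finally have "x [^] B \<in> P" using P.r_coset_eq_one_iff xc by blast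
    then have "generate G {x [^] B} \<subseteq> P" by (intro generate_subgroup_incl sP) simp
    then show "x \<in> P" using xin by blast
  qed
qed

lemma card_p_elements_if_primary_commuting:
  assumes primary_commuting "prime p"
  shows "card (p_elements p) = p ^ multiplicity p (order G)"
proof -
  obtain P where P: "sylow_subgroup G p P" using ex_sylow_subgroup[OF assms(2)] by blast
  then show ?thesis using sylow_eq_p_elements[OF assms P] by (simp add: sylow_subgroup_def)
qed

text \<open>The count leaves no \<open>p\<close>-element outside a Sylow subgroup, so the
  \<open>p\<close>-elements form a subgroup, stable under conjugation. The commutator of a
  \<open>p\<close>-element and a \<open>q\<close>-element is then both a \<open>p\<close>-element
  and a \<open>q\<close>-element, hence trivial.\<close>

lemma primary_commuting_if_card_p_elements:
  assumes card: "\<And>p. prime p \<Longrightarrow> card (p_elements p) = p ^ multiplicity p (order G)"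
  shows primary_commuting
  unfolding primary_commuting_def
proof (intro allI impI)
  have sub: "subgroup (p_elements p) G" if p: "prime p" for p
  proof -
    obtain P where P: "sylow_subgroup G p P" using ex_sylow_subgroup[OF p] by blast
    have "finite (p_elements p)" by (simp add: p_elements_def)
    then have "P = p_elements p"
      using card_subset_eq[OF _ sylow_subset_p_elements[OF p P]] card[OF p] P
      by (simp add: sylow_subgroup_def)
    then show ?thesis using P by (simp add: sylow_subgroup_def)
  qed
  have conj: "g \<otimes> x \<otimes> inv g \<in> p_elements p" if "g \<in> carrier G" "x \<in> p_elements p" for g x p
    using that ord_conj by (auto simp: p_elements_def)
  fix p q x y assume p: "prime p" and q: "prime q" and pq: "p \<noteq> q"
    and x: "x \<in> p_elements p" and y: "y \<in> p_elements q"
  have xc: "x \<in> carrier G" and yc: "y \<in> carrier G" using x y by (auto simp: p_elements_def)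
  let ?c = "x \<otimes> y \<otimes> inv x \<otimes> inv y"
  have "?c \<in> p_elements q"
    using conj[OF xc y] subgroup.m_inv_closed[OF sub[OF q] y] subgroup.m_closed[OF sub[OF q]] by blast
  moreover have "?c \<in> p_elements p"
  proof -
    have "?c = x \<otimes> (y \<otimes> inv x \<otimes> inv y)" using xc yc by (simp add: m_assoc)
    then show ?thesis
      using conj[OF yc subgroup.m_inv_closed[OF sub[OF p] x]] x subgroup.m_closed[OF sub[OF p]] by simp
  qed
  ultimately obtain i j where c: "?c \<in> carrier G" "ord ?c = p ^ i" "ord ?c = q ^ j"
    by (auto simp: p_elements_def)
  have "coprime (p ^ i) (q ^ j)" using p q pq by (simp add: primes_coprime)
  then have "ord ?c = 1" using c by (metis coprime_self is_unit_gcd nat_dvd_1_iff_1)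
  then have "?c = \<one>" using ord_eq_1[OF c(1)] by blast
  then show "x \<otimes> y = y \<otimes> x" using commutator_eq_one_iff xc yc by blast
qed

lemma primary_commuting_if_nilpotent:
  assumes "nilpotent_group G"
  shows primary_commuting
  unfolding primary_commuting_def
proof (intro allI impI)
  fix p q x y assume "prime p" "prime q" "p \<noteq> q" "x \<in> p_elements p" "y \<in> p_elements q"
  then have "coprime (ord x) (ord y)" by (auto simp: p_elements_def primes_coprime)
  then show "x \<otimes> y = y \<otimes> x"
    using nilpotent_coprime_ord_commute[OF assms, of x y] \<open>x \<in> _\<close> \<open>y \<in> _\<close> by (simp add: p_elements_def)
qed

end

section \<open>Centres, quotients and the descent of the lower central series\<close>

context finite_group
begin

text \<open>The class equation: with a trivial centre every conjugacy class except that of the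
  identity has size divisible by \<open>p\<close>, so the group order would be 1 modulo
  \<open>p\<close>.\<close>

lemma p_group_center:
  assumes p: "prime p" and ord: "order G = p ^ e" and e: "e > 0"
  shows "\<exists>x\<in>carrier G. x \<noteq> \<one> \<and> (\<forall>g\<in>carrier G. x \<otimes> g = g \<otimes> x)"
proof (rule ccontr)
  assume nc: "\<not> ?thesis"
  define \<phi> where "\<phi> = (\<lambda>g. \<lambda>h \<in> carrier G. g \<otimes> h \<otimes> inv g)"
  interpret a: group_action G "carrier G" \<phi> unfolding \<phi>_def by (rule action_by_conjugation)
  let ?O = "orbits G (carrier G) \<phi>"
  have orb: "orbit G \<phi> x = {g \<otimes> x \<otimes> inv g | g. g \<in> carrier G}" if "x \<in> carrier G" for x
    using that by (auto simp: orbit_def \<phi>_def)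
  have "orbit G \<phi> \<one> = {\<one>}" unfolding orb[OF one_closed] by (auto intro!: exI[of _ \<one>])
  then have one: "{\<one>} \<in> ?O" unfolding orbits_def by (metis (mono_tags, lifting) mem_Collect_eq one_closed)
  have finO: "finite ?O" by (simp add: orbits_def)
  have pdvd: "p dvd card o'" if o': "o' \<in> ?O - {{\<one>}}" for o'
  proof -
    obtain x where x: "x \<in> carrier G" "o' = orbit G \<phi> x" using o' by (auto simp: orbits_def)
    have x1: "x \<noteq> \<one>" using o' x \<open>orbit G \<phi> \<one> = {\<one>}\<close> by auto
    then obtain g where g: "g \<in> carrier G" "x \<otimes> g \<noteq> g \<otimes> x" using nc x by blast
    have ne: "g \<otimes> x \<otimes> inv g \<noteq> x"
    proof
      assume "g \<otimes> x \<otimes> inv g = x"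
      then have "x \<otimes> g = g \<otimes> x \<otimes> inv g \<otimes> g" by simp
      then show False using g x by (simp add: m_assoc)
    qed
    have "x \<in> o'" unfolding x(2) orb[OF x(1)] using x(1) by (auto intro!: exI[of _ \<one>])
    moreover have "g \<otimes> x \<otimes> inv g \<in> o'" unfolding x(2) orb[OF x(1)] using g by blast
    ultimately have "card o' \<noteq> 1" using ne by (metis card_1_singletonE singletonD)
    moreover have "card o' dvd p ^ e"
      using a.orbit_stabilizer_theorem[OF x(1)] x(2) ord by (metis dvd_triv_left)
    then obtain i where "card o' = p ^ i" using p divides_primepow_nat by blast
    ultimately show ?thesis by (cases i) auto
  qed
  have "order G = (\<Sum>o'\<in>?O. card o')"
    using a.disjoint_sum[OF fin, of "\<lambda>_. 1 :: nat"] by (simp add: order_def)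
  also have "\<dots> = card {\<one>} + (\<Sum>o'\<in>?O - {{\<one>}}. card o')" using finO one by (rule sum.remove)
  finally have "order G = 1 + (\<Sum>o'\<in>?O - {{\<one>}}. card o')" by simp
  moreover have "p dvd (\<Sum>o'\<in>?O - {{\<one>}}. card o')" using pdvd by (rule dvd_sum)
  moreover have "p dvd order G" using ord e by (simp add: dvd_power)
  ultimately have "p dvd 1" by (metis dvd_add_left_iff)
  then show False using p by (simp add: not_prime_unit)
qed

lemma finite_group_subgroup:
  assumes "subgroup K G"
  shows "finite_group (G\<lparr>carrier := K\<rparr>)"
  using subgroup_imp_group[OF assms] subgroup_finite[OF assms]
  by (intro finite_group.intro finite_group_axioms.intro) simp_all

lemma finite_group_Mod:
  assumes "N \<lhd> G"
  shows "finite_group (G Mod N)"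
proof -
  have "finite (carrier (G Mod N))" by (simp add: FactGroup_def RCOSETS_def)
  then show ?thesis using normal.factorgroup_is_group[OF assms]
    by (intro finite_group.intro finite_group_axioms.intro)
qed

text \<open>A central element of a nontrivial Sylow \<open>p\<close>-subgroup commutes with that
  subgroup and, by hypothesis, with the Sylow subgroups for all other primes. Its centralizer is
  therefore the whole group.\<close>

lemma center_nontrivial_if_primary_commuting:
  assumes C: primary_commuting and nt: "carrier G \<noteq> {\<one>}"
  shows "\<exists>x\<in>carrier G. x \<noteq> \<one> \<and> (\<forall>g\<in>carrier G. x \<otimes> g = g \<otimes> x)"
proof -
  have "order G \<noteq> 1"
  proof
    assume "order G = 1"
    then obtain x where "carrier G = {x}" unfolding order_def by (rule card_1_singletonE)
    then show False using nt one_closed by (metis singletonD)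
  qed
  then obtain p where p: "prime p" "p dvd order G" using prime_factor_nat by blast
  obtain P where P: "sylow_subgroup G p P" using ex_sylow_subgroup[OF p(1)] by blast
  have sP: "subgroup P G" and cP: "card P = p ^ multiplicity p (order G)"
    using P by (auto simp: sylow_subgroup_def)
  interpret P: finite_group "G\<lparr>carrier := P\<rparr>" by (rule finite_group_subgroup[OF sP])
  have "multiplicity p (order G) > 0"
    using p order_pos by (simp add: prime_multiplicity_gt_zero_iff)
  then obtain x where x: "x \<in> P" "x \<noteq> \<one>" "\<forall>g\<in>P. x \<otimes> g = g \<otimes> x"
    using P.p_group_center[OF p(1)] cP by (auto simp: order_def)
  have xc: "x \<in> carrier G" using subgroup.mem_carrier[OF sP x(1)] .
  have "{g \<in> carrier G. x \<otimes> g = g \<otimes> x} = carrier G"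
  proof (rule subgroup_eq_carrier_if_sylow[OF commuting_elements_subgroup[OF xc]])
    fix q :: nat assume q: "prime q"
    show "\<exists>Q. sylow_subgroup G q Q \<and> Q \<subseteq> {g \<in> carrier G. x \<otimes> g = g \<otimes> x}"
    proof (cases "q = p")
      case True
      have "P \<subseteq> {g \<in> carrier G. x \<otimes> g = g \<otimes> x}" using x subgroup.subset[OF sP] by blast
      then show ?thesis using P True by blast
    next
      case False
      obtain Q where Q: "sylow_subgroup G q Q" using ex_sylow_subgroup[OF q] by blast
      have "x \<in> p_elements p" using sylow_subset_p_elements[OF p(1) P] x by blast
      moreover have QQ: "Q \<subseteq> p_elements q" by (rule sylow_subset_p_elements[OF q Q])
      ultimately have "Q \<subseteq> {g \<in> carrier G. x \<otimes> g = g \<otimes> x}"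
        using C p(1) q False unfolding primary_commuting_def p_elements_def by blast
      then show ?thesis using Q by blast
    qed
  qed
  then show ?thesis using xc x(2) by blast
qed

lemma ex_p_part_exponent:
  assumes "prime p" "n > 0"
  obtains u :: nat where "[u = 1] (mod p ^ multiplicity p n)" "[u = 0] (mod (n div p ^ multiplicity p n))"
proof -
  have "\<not> p dvd n div p ^ multiplicity p n"
    using assms(2) prime_gt_1_nat[OF assms(1)] by (intro multiplicity_decompose) auto
  then have "coprime (p ^ multiplicity p n) (n div p ^ multiplicity p n)"
    using assms(1) by (simp add: prime_imp_coprime)
  then show ?thesis using binary_chinese_remainder_nat[of _ _ 1 0] that by blast
qed

lemma pow_mem_p_elements:
  assumes p: "prime p" and x: "x \<in> carrier G"
    and u: "[u = 0] (mod (order G div p ^ multiplicity p (order G)))"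
  shows "x [^] u \<in> p_elements p"
proof -
  define e where "e = multiplicity p (order G)"
  have "order G div p ^ e dvd u" using u by (simp add: cong_0_iff e_def)
  then have "(order G div p ^ e) * p ^ e dvd u * p ^ e" by (simp add: mult_dvd_mono)
  then have "order G dvd u * p ^ e" by (simp add: e_def multiplicity_dvd)
  then have "ord x dvd u * p ^ e" using ord_dvd_group_order[OF x] dvd_trans by blast
  then have "(x [^] u) [^] (p ^ e) = \<one>" using x by (simp add: nat_pow_pow pow_eq_id)
  then have "ord (x [^] u) dvd p ^ e" using x pow_eq_id by simp
  then show ?thesis using p divides_primepow_nat x by (auto simp: p_elements_def)
qed

lemma pow_cong_one:
  assumes x: "x \<in> carrier G" and u: "[u = 1] (mod ord x)"
  shows "x [^] (u::nat) = x"
proof -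
  have "int (ord x) dvd int 1 - int u" using u by (metis cong_iff_dvd_diff cong_int_iff cong_sym)
  then show ?thesis using int_pow_eq[OF x, of "int u" "int 1"] x by (simp add: int_pow_int)
qed

text \<open>A \<open>p\<close>-element \<open>U\<close> of the quotient lifts to a
  \<open>p\<close>-element: raise any preimage to an exponent that is 1 modulo the
  \<open>p\<close>-part of \<open>order G\<close> and 0 modulo the rest. As the order of
  \<open>U\<close> divides that \<open>p\<close>-part, \<open>U\<close> itself is unchanged by this
  power.\<close>

lemma primary_commuting_Mod:
  assumes C: primary_commuting and N: "N \<lhd> G"
  shows "finite_group.primary_commuting (G Mod N)"
proof -
  interpret N: normal N G by fact
  let ?Q = "G Mod N"
  interpret Q: finite_group ?Q by (rule finite_group_Mod[OF N])
  interpret q: group_hom G ?Q "\<lambda>x. N #> x" by (rule N.group_hom_Mod)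
  have dvd: "order ?Q dvd order G"
    using lagrange[OF N.is_subgroup] by (metis dvd_triv_left order_def FactGroup_def partial_object.select_convs(1))
  have lift: "\<exists>x\<in>p_elements p. U = N #> x" if p: "prime p" and U: "U \<in> Q.p_elements p" for p U
  proof -
    have Xc: "U \<in> carrier ?Q" and "\<exists>i. Q.ord U = p ^ i" using U by (auto simp: Q.p_elements_def)
    then obtain i where i: "Q.ord U = p ^ i" by blast
    obtain x where x: "x \<in> carrier G" "U = N #> x" using Xc by (auto simp: FactGroup_def RCOSETS_def)
    define e where "e = multiplicity p (order G)"
    obtain u where u: "[u = 1] (mod p ^ e)" "[u = 0] (mod (order G div p ^ e))"
      using ex_p_part_exponent[OF p order_pos] unfolding e_def by blast
    have px: "x [^] u \<in> p_elements p" using pow_mem_p_elements[OF p x(1)] u(2) by (simp add: e_def)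
    have "p ^ i dvd order G" using Q.ord_dvd_group_order[OF Xc] i dvd dvd_trans by metis
    then have "i \<le> e" unfolding e_def using p order_pos by (intro multiplicity_geI) auto
    then have "[u = 1] (mod p ^ i)" using u(1) cong_dvd_modulus_nat le_imp_power_dvd by blast
    then have "U [^]\<^bsub>?Q\<^esub> u = U" using Q.pow_cong_one[OF Xc] i by simp
    then have "N #> (x [^] u) = U" using x by (simp only: q.hom_nat_pow)
    then show ?thesis using px by blast
  qed
  show ?thesis unfolding Q.primary_commuting_def
  proof (intro allI impI)
    fix p q U V assume pq: "prime p" "prime q" "p \<noteq> q" and U: "U \<in> Q.p_elements p" and V: "V \<in> Q.p_elements q"
    obtain x where x: "x \<in> p_elements p" "U = N #> x" using lift pq U by blast
    obtain y where y: "y \<in> p_elements q" "V = N #> y" using lift pq V by blast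
    have "x \<otimes> y = y \<otimes> x" using C pq x y unfolding primary_commuting_def by blast
    moreover have "x \<in> carrier G" "y \<in> carrier G" using x y by (auto simp: p_elements_def)
    ultimately show "U \<otimes>\<^bsub>?Q\<^esub> V = V \<otimes>\<^bsub>?Q\<^esub> U" unfolding x y by (metis q.hom_mult)
  qed
qed

text \<open>Induction on the distance from \<open>N\<close> up to the whole group. The preimage
  \<open>M\<close> of the centre of \<open>G Mod N\<close> is strictly larger than a proper
  \<open>N\<close>, and commutators of \<open>M\<close> with \<open>G\<close> fall into
  \<open>N\<close>; once the series is inside \<open>M\<close>, one more step brings it into
  \<open>N\<close>.\<close>

lemma lower_central_series_reaches:
  assumes C: primary_commuting and "N \<lhd> G"
  shows "\<exists>n. (lower_central_step G ^^ n) (carrier G) \<subseteq> N"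
  using assms(2)
proof (induction "order G - card N" arbitrary: N rule: less_induct)
  case less
  interpret N: normal N G by (rule less.prems)
  show ?case
  proof (cases "N = carrier G")
    case True
    then show ?thesis by (intro exI[of _ 0]) simp
  next
    case False
    let ?Q = "G Mod N"
    interpret Q: finite_group ?Q by (rule finite_group_Mod[OF less.prems])
    interpret q: group_hom G ?Q "\<lambda>x. N #> x" by (rule N.group_hom_Mod)
    have "carrier ?Q \<noteq> {\<one>\<^bsub>?Q\<^esub>}"
    proof
      assume triv: "carrier ?Q = {\<one>\<^bsub>?Q\<^esub>}"
      have "x \<in> N" if "x \<in> carrier G" for x
        using q.hom_closed[OF that] triv N.r_coset_eq_one_iff[OF that] by blast
      then show False using False N.subset by blast
    qed
    then obtain U where U: "U \<in> carrier ?Q" "U \<noteq> \<one>\<^bsub>?Q\<^esub>" "\<forall>V\<in>carrier ?Q. U \<otimes>\<^bsub>?Q\<^esub> V = V \<otimes>\<^bsub>?Q\<^esub> U"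
      using Q.center_nontrivial_if_primary_commuting primary_commuting_Mod[OF C less.prems] by blast
    define M where "M = {x \<in> carrier G. \<forall>V\<in>carrier ?Q. (N #> x) \<otimes>\<^bsub>?Q\<^esub> V = V \<otimes>\<^bsub>?Q\<^esub> (N #> x)}"
    have comm: "x \<otimes> g \<otimes> inv x \<otimes> inv g \<in> N" if "x \<in> M" "g \<in> carrier G" for x g
      using that N.commutator_mem_iff[of x g] q.hom_closed[OF that(2)] by (auto simp: M_def)
    have NM: "N \<subseteq> M"
    proof
      fix x assume x: "x \<in> N"
      then have "N #> x = \<one>\<^bsub>?Q\<^esub>" using N.r_coset_eq_one_iff N.mem_carrier by blast
      moreover have "\<one>\<^bsub>?Q\<^esub> \<otimes>\<^bsub>?Q\<^esub> V = V \<otimes>\<^bsub>?Q\<^esub> \<one>\<^bsub>?Q\<^esub>" if "V \<in> carrier ?Q" for V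
        using Q.l_one[OF that] Q.r_one[OF that] by (simp only:)
      ultimately show "x \<in> M" using N.mem_carrier[OF x] unfolding M_def by (simp only: mem_Collect_eq) blast
    qed
    have sM: "subgroup M G"
    proof (rule finite_subgroupI)
      show "\<one> \<in> M" using NM N.one_closed by blast
      fix x y assume "x \<in> M" "y \<in> M"
      then have xy: "x \<in> carrier G" "y \<in> carrier G"
          "\<And>V. V \<in> carrier ?Q \<Longrightarrow> (N #> x) \<otimes>\<^bsub>?Q\<^esub> V = V \<otimes>\<^bsub>?Q\<^esub> (N #> x)"
          "\<And>V. V \<in> carrier ?Q \<Longrightarrow> (N #> y) \<otimes>\<^bsub>?Q\<^esub> V = V \<otimes>\<^bsub>?Q\<^esub> (N #> y)"
        by (auto simp: M_def)
      have "(N #> (x \<otimes> y)) \<otimes>\<^bsub>?Q\<^esub> V = V \<otimes>\<^bsub>?Q\<^esub> (N #> (x \<otimes> y))" if V: "V \<in> carrier ?Q" for V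
      proof -
        have c: "N #> x \<in> carrier ?Q" "N #> y \<in> carrier ?Q" using q.hom_closed xy by blast+
        have "(N #> x) \<otimes>\<^bsub>?Q\<^esub> (N #> y) \<otimes>\<^bsub>?Q\<^esub> V = (N #> x) \<otimes>\<^bsub>?Q\<^esub> (V \<otimes>\<^bsub>?Q\<^esub> (N #> y))"
          using c V xy(4)[OF V] by (simp only: Q.m_assoc)
        also have "\<dots> = (N #> x) \<otimes>\<^bsub>?Q\<^esub> V \<otimes>\<^bsub>?Q\<^esub> (N #> y)" using c V by (simp only: Q.m_assoc)
        also have "\<dots> = V \<otimes>\<^bsub>?Q\<^esub> ((N #> x) \<otimes>\<^bsub>?Q\<^esub> (N #> y))" using c V xy(3)[OF V] by (simp only: Q.m_assoc)
        finally show ?thesis using xy by (simp only: q.hom_mult)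
      qed
      then show "x \<otimes> y \<in> M" unfolding M_def mem_Collect_eq using m_closed[OF xy(1,2)] by blast
    qed (auto simp: M_def)
    have nM: "M \<lhd> G"
      unfolding normal_inv_iff
    proof (intro conjI ballI sM)
      fix g x assume g: "g \<in> carrier G" and x: "x \<in> M"
      have xc: "x \<in> carrier G" using x by (simp add: M_def)
      have "g \<otimes> x \<otimes> inv g = (x \<otimes> g \<otimes> inv x \<otimes> inv g) \<otimes> inv (x \<otimes> g \<otimes> inv x \<otimes> inv g) \<otimes> (g \<otimes> x \<otimes> inv g)"
        using g xc by simp
      \<comment> \<open>A conjugate of \<open>x\<close> differs from \<open>x\<close> by a
        commutator, which lies in \<open>N\<close> and hence in \<open>M\<close>.\<close>
      moreover have "inv (x \<otimes> g \<otimes> inv x \<otimes> inv g) \<otimes> x = g \<otimes> x \<otimes> inv g"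
        using g xc by (simp add: m_assoc inv_mult_group)
      ultimately show "g \<otimes> x \<otimes> inv g \<in> M"
        using NM comm[OF x g] x subgroup.m_closed[OF sM] subgroup.m_inv_closed[OF sM] by (metis subsetD)
    qed
    have "card N < card M"
    proof (rule psubset_card_mono[OF subgroup_finite[OF sM]])
      obtain x where x: "x \<in> carrier G" "U = N #> x" using U(1) by (auto simp: FactGroup_def RCOSETS_def)
      have "x \<in> M" unfolding M_def mem_Collect_eq using x U(3) by blast
      moreover have "x \<notin> N" using x U N.r_coset_eq_one_iff by blast
      ultimately show "N \<subset> M" using NM by blast
    qed
    moreover have "card M \<le> order G" unfolding order_def by (rule card_mono[OF fin subgroup.subset[OF sM]])
    ultimately have "order G - card M < order G - card N" by linarith
    from less.hyps[OF this nM] obtain n where "(lower_central_step G ^^ n) (carrier G) \<subseteq> M" by blast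
    then have "(lower_central_step G ^^ Suc n) (carrier G) \<subseteq> lower_central_step G M"
      using lower_central_step_mono by simp
    also have "\<dots> \<subseteq> N"
      unfolding lower_central_step_def
      by (rule generate_subgroup_incl[OF _ N.is_subgroup]) (use comm in blast)
    finally show ?thesis by blast
  qed
qed

lemma nilpotent_if_primary_commuting:
  assumes primary_commuting
  shows "nilpotent_group G"
proof -
  obtain n where n: "(lower_central_step G ^^ n) (carrier G) \<subseteq> {\<one>}"
    using lower_central_series_reaches[OF assms one_is_normal] by blast
  have "\<one> \<in> (lower_central_step G ^^ n) (carrier G)"
    using lower_central_series_normal normal_imp_subgroup subgroup.one_closed by blast
  then show ?thesis unfolding nilpotent_group_def using n is_group by blast
qed

text \<open>The right-hand side depends only on the number of elements of each order, so nilpotency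
  passes along any order-preserving bijection.\<close>

theorem nilpotent_iff_card_p_elements:
  "nilpotent_group G \<longleftrightarrow> (\<forall>p. prime p \<longrightarrow> card (p_elements p) = p ^ multiplicity p (order G))"
  using card_p_elements_if_primary_commuting primary_commuting_if_card_p_elements
    primary_commuting_if_nilpotent nilpotent_if_primary_commuting by blast

end

section \<open>Gluing Sylow subgroups\<close>

text \<open>A family \<open>u\<close> such that \<open>x \<mapsto> x ^ u p\<close> is the projection onto the Sylow \<open>p\<close>-subgroup of a
  nilpotent group of order \<open>n\<close>.\<close>
definition p_part_exponents :: "nat \<Rightarrow> (nat \<Rightarrow> nat) \<Rightarrow> bool" where
  "p_part_exponents n u \<longleftrightarrow> (\<forall>p\<in>prime_factors n. [u p = 1] (mod p ^ multiplicity p n) \<and>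
     [u p = 0] (mod (n div p ^ multiplicity p n)))"

text \<open>Modulo the \<open>q\<close>-part of \<open>n\<close> every summand except
  \<open>u q\<close> vanishes. Thus the projections multiply to the identity map: an element is the
  product of its \<open>p\<close>-parts.\<close>

lemma sum_p_part_exponents:
  assumes n: "n > 0" and u: "p_part_exponents n u"
  shows "[(\<Sum>p\<in>prime_factors n. u p) = 1] (mod n)"
proof -
  have "[(\<Sum>p\<in>prime_factors n. u p) = 1] (mod (\<Prod>q\<in>prime_factors n. q ^ multiplicity q n))"
  proof (rule coprime_cong_prod_nat)
    fix q r assume "q \<in> prime_factors n" "r \<in> prime_factors n" "q \<noteq> r"
    then show "coprime (q ^ multiplicity q n) (r ^ multiplicity r n)"
      by (simp add: in_prime_factors_iff primes_coprime)
  next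
    fix q assume q: "q \<in> prime_factors n"
    have "[u p = 0] (mod q ^ multiplicity q n)" if p: "p \<in> prime_factors n - {q}" for p
    proof -
      have "coprime (q ^ multiplicity q n) (p ^ multiplicity p n)"
        using p q by (auto simp: in_prime_factors_iff primes_coprime)
      moreover have "q ^ multiplicity q n dvd p ^ multiplicity p n * (n div p ^ multiplicity p n)"
        by (simp add: multiplicity_dvd)
      ultimately have "q ^ multiplicity q n dvd n div p ^ multiplicity p n"
        by (simp add: coprime_dvd_mult_right_iff)
      then show ?thesis using u p unfolding p_part_exponents_def by (meson DiffD1 cong_dvd_modulus_nat)
    qed
    then have "[(\<Sum>p\<in>prime_factors n - {q}. u p) = (\<Sum>p\<in>prime_factors n - {q}. 0)] (mod q ^ multiplicity q n)"
      by (intro cong_sum) auto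
    moreover have "[u q = 1] (mod q ^ multiplicity q n)" using u q by (simp add: p_part_exponents_def)
    ultimately have "[u q + (\<Sum>p\<in>prime_factors n - {q}. u p) = 1 + 0] (mod q ^ multiplicity q n)"
      by (intro cong_add) simp_all
    then show "[(\<Sum>p\<in>prime_factors n. u p) = 1] (mod q ^ multiplicity q n)"
      using q by (simp add: sum.remove)
  qed
  then show ?thesis using prime_factorization_nat[OF n] by simp
qed

lemma (in finite_group) ex_p_part_exponents: "\<exists>u. p_part_exponents (order G) u"
proof -
  have "\<exists>v. [v = 1] (mod p ^ multiplicity p (order G)) \<and>
      [v = 0] (mod (order G div p ^ multiplicity p (order G)))" if "p \<in> prime_factors (order G)" for p
    using ex_p_part_exponent[OF _ order_pos, of p] that by (metis in_prime_factors_iff)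
  then show ?thesis unfolding p_part_exponents_def by metis
qed

locale p_parts = finite_group +
  fixes u :: "nat \<Rightarrow> nat"
  assumes primary: primary_commuting and exps: "p_part_exponents (order G) u"
begin

abbreviation primes where "primes \<equiv> prime_factors (order G)"

lemma pow_sum_exponents: "x \<in> carrier G \<Longrightarrow> x [^] (\<Sum>p\<in>primes. u p) = x"
  using pow_cong_one sum_p_part_exponents[OF order_pos exps] ord_dvd_group_order cong_dvd_modulus_nat
  by blast

lemma p_part_mem: "p \<in> primes \<Longrightarrow> x \<in> carrier G \<Longrightarrow> x [^] u p \<in> p_elements p"
  using pow_mem_p_elements exps unfolding p_part_exponents_def by (simp add: in_prime_factors_iff)

lemma p_parts_inj:
  assumes "x \<in> carrier G" "y \<in> carrier G" "\<And>p. p \<in> primes \<Longrightarrow> x [^] u p = y [^] u p"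
  shows "x = y"
proof -
  have "x [^] (\<Sum>p\<in>A. u p) = y [^] (\<Sum>p\<in>A. u p)" if "finite A" "A \<subseteq> primes" for A
    using that assms by (induction A rule: finite_induct) (auto simp flip: nat_pow_mult)
  then show ?thesis using pow_sum_exponents assms by (metis finite_set_mset order_refl)
qed

text \<open>Surjectivity by counting: the map to the tuple of \<open>p\<close>-parts is injective,
  and the product of the sizes of the sets of \<open>p\<close>-elements is the group order.\<close>

lemma ex_p_parts:
  assumes v: "\<And>p. p \<in> primes \<Longrightarrow> v p \<in> p_elements p"
  shows "\<exists>x\<in>carrier G. \<forall>p\<in>primes. x [^] u p = v p"
proof -
  define \<psi> where "\<psi> x = (\<lambda>p\<in>primes. x [^] u p)" for x
  have inj: "inj_on \<psi> (carrier G)"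
  proof (rule inj_onI)
    fix x y assume xy: "x \<in> carrier G" "y \<in> carrier G" "\<psi> x = \<psi> y"
    have "x [^] u p = y [^] u p" if "p \<in> primes" for p
      using fun_cong[OF xy(3), of p] that by (simp add: \<psi>_def)
    then show "x = y" using p_parts_inj xy by blast
  qed
  have sub: "\<psi> ` carrier G \<subseteq> PiE primes p_elements"
    using p_part_mem by (auto simp: \<psi>_def)
  have "card (PiE primes p_elements) = (\<Prod>p\<in>primes. card (p_elements p))" by (rule card_PiE) simp
  also have "\<dots> = (\<Prod>p\<in>primes. p ^ multiplicity p (order G))"
    using card_p_elements_if_primary_commuting[OF primary] by (intro prod.cong) auto
  also have "\<dots> = order G" using prime_factorization_nat[OF order_pos] by simp
  finally have "card (PiE primes p_elements) = card (\<psi> ` carrier G)"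
    using card_image[OF inj] by (simp add: order_def)
  moreover have "finite (PiE primes p_elements)" by (intro finite_PiE) (auto simp: p_elements_def)
  ultimately have surj: "\<psi> ` carrier G = PiE primes p_elements" using sub by (metis card_subset_eq)
  have "restrict v primes \<in> PiE primes p_elements" using v by auto
  then obtain x where x: "x \<in> carrier G" "\<psi> x = restrict v primes" using surj by (metis imageE)
  have "x [^] u p = v p" if "p \<in> primes" for p
    using fun_cong[OF x(2), of p] that by (simp add: \<psi>_def)
  then show ?thesis using x by blast
qed

text \<open>Taking \<open>p\<close>-parts commutes with powers. Conversely, each part of
  \<open>x\<close> lies in the subgroup generated by \<open>y\<close>, and \<open>x\<close> is their
  product.\<close>

lemma mem_generate_iff_p_parts:
  assumes x: "x \<in> carrier G" and y: "y \<in> carrier G"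
  shows "x \<in> generate G {y} \<longleftrightarrow> (\<forall>p\<in>primes. x [^] u p \<in> generate G {y [^] u p})"
proof
  assume "x \<in> generate G {y}"
  then obtain k :: nat where k: "x = y [^] k" using mem_generate_iff[OF y] by blast
  have "x [^] u p = (y [^] u p) [^] k" for p using y k by (simp add: nat_pow_pow mult.commute)
  then show "\<forall>p\<in>primes. x [^] u p \<in> generate G {y [^] u p}" using mem_generate_iff y by auto
next
  assume le: "\<forall>p\<in>primes. x [^] u p \<in> generate G {y [^] u p}"
  have sub: "subgroup (generate G {y}) G" using y by (intro generate_is_subgroup) simp
  have mem: "x [^] u p \<in> generate G {y}" if "p \<in> primes" for p
  proof -
    have "y [^] u p \<in> generate G {y}" using mem_generate_iff[OF y] by blast
    then show ?thesis using le that generate_trans[OF y] by blast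
  qed
  have "x [^] (\<Sum>p\<in>A. u p) \<in> generate G {y}" if "finite A" "A \<subseteq> primes" for A
    using that
  proof (induction A rule: finite_induct)
    case empty
    show ?case using subgroup.one_closed[OF sub] by simp
  next
    case (insert p A)
    then have "x [^] (\<Sum>p\<in>insert p A. u p) = x [^] u p \<otimes> x [^] (\<Sum>p\<in>A. u p)"
      using x by (simp add: nat_pow_mult)
    then show ?case using insert subgroup.m_closed[OF sub] mem by simp
  qed
  then have "x [^] (\<Sum>p\<in>primes. u p) \<in> generate G {y}" by simp
  then show "x \<in> generate G {y}" using pow_sum_exponents[OF x] by simp
qed

end

section \<open>Restriction to Sylow subgroups and assembly from them\<close>

lemma (in finite_group) sylow_p_elements:
  assumes primary_commuting "prime p"
  shows "sylow_subgroup G p (p_elements p)"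
  using ex_sylow_subgroup[OF assms(2)] sylow_eq_p_elements[OF assms] by metis

lemma directed_power_iso_restrict:
  assumes "group G" "group H" "subgroup P G" "subgroup Q H" "bij_betw g P Q"
  shows "directed_power_iso (G\<lparr>carrier := P\<rparr>) (H\<lparr>carrier := Q\<rparr>) g \<longleftrightarrow>
    (\<forall>x\<in>P. \<forall>y\<in>P. x \<in> generate G {y} \<longleftrightarrow> g x \<in> generate H {g y})"
proof -
  have "generate (G\<lparr>carrier := P\<rparr>) {y} = generate G {y}" if "y \<in> P" for y
    using group.generate_consistent[OF assms(1) _ assms(3)] that by simp
  moreover have "generate (H\<lparr>carrier := Q\<rparr>) {g y} = generate H {g y}" if "y \<in> P" for y
    using group.generate_consistent[OF assms(2) _ assms(4), of "{g y}"] bij_betwE[OF assms(5)] that by simp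
  ultimately show ?thesis using assms(5) by (simp add: directed_power_iso_def)
qed

lemma directed_power_iso_p_elements:
  assumes "finite_group G" "finite_group H" "directed_power_iso G H g"
  shows "bij_betw g (finite_group.p_elements G p) (finite_group.p_elements H p)"
proof -
  interpret G: finite_group G by fact
  interpret H: finite_group H by fact
  have bij: "bij_betw g (carrier G) (carrier H)" using assms(3) by (simp add: directed_power_iso_def)
  have iff: "g x \<in> H.p_elements p \<longleftrightarrow> x \<in> G.p_elements p" if "x \<in> carrier G" for x
    using directed_power_iso_ord[OF assms that] that bij_betwE[OF bij]
    by (auto simp: G.p_elements_def H.p_elements_def)
  have sub: "G.p_elements p \<subseteq> carrier G" "H.p_elements p \<subseteq> carrier H"
    by (auto simp: G.p_elements_def H.p_elements_def)
  have "g ` G.p_elements p = H.p_elements p"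
  proof (intro equalityI subsetI)
    fix z assume z: "z \<in> H.p_elements p"
    then have "z \<in> g ` carrier G" using sub bij unfolding bij_betw_def by blast
    then obtain x where "x \<in> carrier G" "z = g x" by blast
    then show "z \<in> g ` G.p_elements p" using iff z by blast
  qed (use iff sub in blast)
  then show ?thesis using bij_betw_subset[OF bij sub(1)] by blast
qed

lemma power_graph_iso_imp_nilpotent:
  assumes G: "finite_group G" and H: "finite_group H"
    and nil: "nilpotent_group G" and iso: "directed_power_iso G H g"
  shows "nilpotent_group H"
proof -
  interpret G: finite_group G by fact
  interpret H: finite_group H by fact
  have "order H = order G"
    using iso bij_betw_same_card unfolding directed_power_iso_def order_def by metis
  moreover have "card (H.p_elements p) = card (G.p_elements p)" for p
    using bij_betw_same_card[OF directed_power_iso_p_elements[OF G H iso]] by simp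
  ultimately show ?thesis
    using nil unfolding G.nilpotent_iff_card_p_elements H.nilpotent_iff_card_p_elements by simp
qed

text \<open>In nilpotent groups the Sylow subgroups are the sets of \<open>p\<close>-elements, and
  \<open>g\<close> matches these because it preserves orders; so \<open>g\<close> itself
  restricts.\<close>

lemma power_graph_iso_sylow:
  assumes G: "finite_group G" and H: "finite_group H"
    and nil: "nilpotent_group G" and iso: "directed_power_iso G H g"
    and p: "prime p" and P: "sylow_subgroup G p P" and Q: "sylow_subgroup H p Q"
  shows "power_graph_iso (G\<lparr>carrier := P\<rparr>) (H\<lparr>carrier := Q\<rparr>)"
proof -
  interpret G: finite_group G by fact
  interpret H: finite_group H by fact
  have nilH: "nilpotent_group H" by (rule power_graph_iso_imp_nilpotent[OF G H nil iso])
  have PQ: "P = G.p_elements p" "Q = H.p_elements p"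
    using G.sylow_eq_p_elements[OF G.primary_commuting_if_nilpotent[OF nil] p P]
      H.sylow_eq_p_elements[OF H.primary_commuting_if_nilpotent[OF nilH] p Q] .
  have bij: "bij_betw g P Q" unfolding PQ by (rule directed_power_iso_p_elements[OF G H iso])
  have sub: "subgroup P G" "subgroup Q H" using P Q by (auto simp: sylow_subgroup_def)
  have "\<forall>x\<in>P. \<forall>y\<in>P. x \<in> generate G {y} \<longleftrightarrow> g x \<in> generate H {g y}"
    using iso subgroup.subset[OF sub(1)] unfolding directed_power_iso_def by blast
  then have "directed_power_iso (G\<lparr>carrier := P\<rparr>) (H\<lparr>carrier := Q\<rparr>) g"
    using directed_power_iso_restrict[OF G.is_group H.is_group sub bij] by blast
  then show ?thesis by (rule directed_power_iso_imp_power_graph_iso)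
qed

text \<open>The isomorphisms of Sylow subgroups are first made directed. They show that the orders
  of \<open>G\<close> and \<open>H\<close> agree, so the same exponents \<open>u\<close> project
  onto primary parts in both groups, and \<open>F\<close> is defined by applying \<open>f p\<close>
  to each \<open>p\<close>-part. Generation is decided part by part, hence \<open>F\<close>
  preserves it.\<close>

lemma ex_directed_power_iso_if_sylow:
  assumes G: "finite_group G" and H: "finite_group H"
    and nilG: "nilpotent_group G" and nilH: "nilpotent_group H"
    and syl: "\<And>p P Q. prime p \<Longrightarrow> sylow_subgroup G p P \<Longrightarrow> sylow_subgroup H p Q \<Longrightarrow>
      power_graph_iso (G\<lparr>carrier := P\<rparr>) (H\<lparr>carrier := Q\<rparr>)"
  shows "\<exists>g. directed_power_iso G H g"
proof -
  interpret G: finite_group G by fact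
  interpret H: finite_group H by fact
  have CG: "G.primary_commuting" by (rule G.primary_commuting_if_nilpotent[OF nilG])
  have CH: "H.primary_commuting" by (rule H.primary_commuting_if_nilpotent[OF nilH])
  have sG: "subgroup (G.p_elements p) G" if "prime p" for p
    using G.sylow_p_elements[OF CG that] by (simp add: sylow_subgroup_def)
  have sH: "subgroup (H.p_elements p) H" if "prime p" for p
    using H.sylow_p_elements[OF CH that] by (simp add: sylow_subgroup_def)
  have "\<exists>f. bij_betw f (G.p_elements p) (H.p_elements p) \<and>
      (\<forall>x\<in>G.p_elements p. \<forall>y\<in>G.p_elements p. x \<in> generate G {y} \<longleftrightarrow> f x \<in> generate H {f y})"
    if p: "prime p" for p
  proof -
    interpret GP: finite_group "G\<lparr>carrier := G.p_elements p\<rparr>" by (rule G.finite_group_subgroup[OF sG[OF p]])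
    interpret HP: finite_group "H\<lparr>carrier := H.p_elements p\<rparr>" by (rule H.finite_group_subgroup[OF sH[OF p]])
    obtain f where f: "directed_power_iso (G\<lparr>carrier := G.p_elements p\<rparr>) (H\<lparr>carrier := H.p_elements p\<rparr>) f"
      using power_graph_iso_imp_directed[OF GP.is_group GP.fin HP.is_group HP.fin]
        syl[OF p G.sylow_p_elements[OF CG p] H.sylow_p_elements[OF CH p]] by blast
    then have bij: "bij_betw f (G.p_elements p) (H.p_elements p)" by (simp add: directed_power_iso_def)
    then show ?thesis
      using f directed_power_iso_restrict[OF G.is_group H.is_group sG[OF p] sH[OF p] bij] by blast
  qed
  then obtain f where f: "\<And>p. prime p \<Longrightarrow> bij_betw (f p) (G.p_elements p) (H.p_elements p)"
      and fle: "\<And>p x y. prime p \<Longrightarrow> x \<in> G.p_elements p \<Longrightarrow> y \<in> G.p_elements p \<Longrightarrow>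
        x \<in> generate G {y} \<longleftrightarrow> f p x \<in> generate H {f p y}"
    by metis
  have "multiplicity p (order G) = multiplicity p (order H)" if p: "prime p" for p
  proof -
    have "p ^ multiplicity p (order G) = p ^ multiplicity p (order H)"
      using bij_betw_same_card[OF f[OF p]] G.card_p_elements_if_primary_commuting[OF CG p]
        H.card_p_elements_if_primary_commuting[OF CH p] by simp
    then show ?thesis using prime_gt_1_nat[OF p] by simp
  qed
  then have ord: "order H = order G"
    using multiplicity_eq_nat[OF G.order_pos H.order_pos] by simp
  obtain u where u: "p_part_exponents (order G) u" using G.ex_p_part_exponents by blast
  interpret PG: p_parts G u using CG u by (intro p_parts.intro p_parts_axioms.intro G)
  interpret PH: p_parts H u using CH u ord by (intro p_parts.intro p_parts_axioms.intro H) simp_all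
  \<comment> \<open>The image of \<open>x\<close> is specified by its primary parts in
    \<open>H\<close>; such an element exists because every tuple of \<open>p\<close>-elements
    occurs.\<close>
  have "\<exists>z\<in>carrier H. \<forall>p\<in>PG.primes. z [^]\<^bsub>H\<^esub> u p = f p (x [^]\<^bsub>G\<^esub> u p)" if x: "x \<in> carrier G" for x
  proof -
    have "f p (x [^]\<^bsub>G\<^esub> u p) \<in> H.p_elements p" if "p \<in> PG.primes" for p
      using bij_betwE[OF f] PG.p_part_mem[OF that x] that by (simp add: in_prime_factors_iff)
    then show ?thesis using PH.ex_p_parts[of "\<lambda>p. f p (x [^]\<^bsub>G\<^esub> u p)"] ord by simp
  qed
  then obtain F where F: "\<And>x. x \<in> carrier G \<Longrightarrow> F x \<in> carrier H"
      and Fp: "\<And>x p. x \<in> carrier G \<Longrightarrow> p \<in> PG.primes \<Longrightarrow> F x [^]\<^bsub>H\<^esub> u p = f p (x [^]\<^bsub>G\<^esub> u p)"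
    by metis
  have "inj_on F (carrier G)"
  proof (rule inj_onI)
    fix x y assume xy: "x \<in> carrier G" "y \<in> carrier G" "F x = F y"
    show "x = y"
    proof (rule PG.p_parts_inj[OF xy(1,2)])
      fix p assume p: "p \<in> PG.primes"
      then have "f p (x [^]\<^bsub>G\<^esub> u p) = f p (y [^]\<^bsub>G\<^esub> u p)" using Fp xy by metis
      then show "x [^]\<^bsub>G\<^esub> u p = y [^]\<^bsub>G\<^esub> u p"
        using f[of p] p PG.p_part_mem[OF p xy(1)] PG.p_part_mem[OF p xy(2)]
        by (simp add: bij_betw_def inj_on_def in_prime_factors_iff)
    qed
  qed
  moreover have "F ` carrier G = carrier H"
    using F ord card_image[OF calculation] by (intro card_subset_eq) (auto simp: order_def)
  ultimately have "bij_betw F (carrier G) (carrier H)" by (simp add: bij_betw_def)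
  moreover have "x \<in> generate G {y} \<longleftrightarrow> F x \<in> generate H {F y}" if xy: "x \<in> carrier G" "y \<in> carrier G" for x y
  proof -
    have "x \<in> generate G {y} \<longleftrightarrow> (\<forall>p\<in>PG.primes. x [^]\<^bsub>G\<^esub> u p \<in> generate G {y [^]\<^bsub>G\<^esub> u p})"
      by (rule PG.mem_generate_iff_p_parts[OF xy])
    also have "\<dots> \<longleftrightarrow> (\<forall>p\<in>PG.primes. f p (x [^]\<^bsub>G\<^esub> u p) \<in> generate H {f p (y [^]\<^bsub>G\<^esub> u p)})"
      using fle PG.p_part_mem xy by (intro ball_cong refl) (auto simp: in_prime_factors_iff)
    also have "\<dots> \<longleftrightarrow> (\<forall>p\<in>PG.primes. F x [^]\<^bsub>H\<^esub> u p \<in> generate H {F y [^]\<^bsub>H\<^esub> u p})"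
      using Fp xy by simp
    also have "\<dots> \<longleftrightarrow> F x \<in> generate H {F y}"
      using PH.mem_generate_iff_p_parts[OF F[OF xy(1)] F[OF xy(2)]] ord by simp
    finally show ?thesis .
  qed
  ultimately show ?thesis unfolding directed_power_iso_def by blast
qed

theorem theorem2:
  fixes G :: "('a, 'b) monoid_scheme" and H :: "('c, 'd) monoid_scheme"
  assumes "group G" "finite (carrier G)" "nilpotent_group G"
    and "group H" "finite (carrier H)"
  shows "power_graph_iso G H \<longleftrightarrow>
           (nilpotent_group H \<and>
            (\<forall>p::nat. Factorial_Ring.prime p \<longrightarrow> (\<forall>P Q. sylow_subgroup G p P \<longrightarrow> sylow_subgroup H p Q \<longrightarrow>
               power_graph_iso (G\<lparr>carrier := P\<rparr>) (H\<lparr>carrier := Q\<rparr>))))"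
proof -
  have G: "finite_group G" and H: "finite_group H"
    using assms by (auto intro: finite_group.intro finite_group_axioms.intro)
  show ?thesis
  proof
    assume "power_graph_iso G H"
    then obtain g where "directed_power_iso G H g"
      using power_graph_iso_imp_directed assms by blast
    then show "nilpotent_group H \<and>
            (\<forall>p::nat. Factorial_Ring.prime p \<longrightarrow> (\<forall>P Q. sylow_subgroup G p P \<longrightarrow> sylow_subgroup H p Q \<longrightarrow>
               power_graph_iso (G\<lparr>carrier := P\<rparr>) (H\<lparr>carrier := Q\<rparr>)))"
      using power_graph_iso_imp_nilpotent[OF G H assms(3)] power_graph_iso_sylow[OF G H assms(3)] by blast
  next
    assume "nilpotent_group H \<and>
            (\<forall>p::nat. Factorial_Ring.prime p \<longrightarrow> (\<forall>P Q. sylow_subgroup G p P \<longrightarrow> sylow_subgroup H p Q \<longrightarrow>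
               power_graph_iso (G\<lparr>carrier := P\<rparr>) (H\<lparr>carrier := Q\<rparr>)))"
    then show "power_graph_iso G H"
      using ex_directed_power_iso_if_sylow[OF G H assms(3)] directed_power_iso_imp_power_graph_iso by blast
  qed
qed

end
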